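(* Let $d\in\{2,3\}$, let $\Omega\subset\mathbb{R}^d$ be a bounded domain with smooth boundary, let $D(x)>0$ be a smoothly varying diffusivity on $\Omega$, and set $M(x)=1/D(x)$, $|M|=\int_\Omega M(x)\,dx$, $\mu(x)=M(x)/|M|$. Let $\kappa>0$ be arbitrary. For a trap density $\rho$ (that is, $\rho\ge 0$ on $\Omega$ and $\int_\Omega\rho\,dx=1$), let $u$ be the solution of $$\Delta u-\kappa\,\rho(x)\,u=-M(x)\ \text{ in }\Omega,\qquad \partial_n u=0\ \text{ on }\partial\Omega .$$ Then for every trap density $\rho$, $$\int_\Omega \mu(x)\,u(x)\,dx\ \ge\ \frac{|M|}{\kappa},$$ with equality if and only if $\rho=\mu$. In particular, $\rho=\mu$ is the unique global minimizer, over all trap densities, of the mean capture time $\int_\Omega\mu u\,dx$ for a particle starting from the distribution $\mu$, and this holds for every $\kappa$. At the optimum $\rho=\mu$ the mean first-passage time is constant, independent of the starting location: $$u(x)\equiv\frac{|M|}{\kappa}.$$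
   Context: Setting: a Brownian particle diffuses in $\Omega$ with reflecting boundary and space-dependent diffusivity $D(x)$; in the Itô interpretation its density satisfies $p_t=\Delta(D(x)p)$. In the absence of traps its equilibrium distribution is $\mu(x)=D^{-1}(x)/\int_\Omega D^{-1}$. There are $N$ small absorbing traps of radius $\varepsilon$ with spatial density $\rho$ ($\rho\ge0$, $\int_\Omega\rho=1$). The trapping strength is $\kappa=N\nu$, where $\nu=4\pi\varepsilon$ for $d=3$ and $\nu=2\pi/\log(1/\varepsilon)$ for $d=2$; mathematically $\kappa$ is just a positive parameter. The mean first-passage time (MFPT) $u(x)$ to the traps from starting point $x$ is described by the homogenized boundary value problem in the claim, and $\int_\Omega \mu u$ is the mean capture time when the starting point is distributed according to $\mu$. Here $\partial_n$ is the normal derivative on $\partial\Omega$. Densities are identified when they agree almost everywhere. *)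

theory Defs
  imports "HOL-Analysis.Analysis"
begin

text \<open>All notions of differentiability below are used on open sets only.\<close>

definition partial :: "'a::euclidean_space \<Rightarrow> ('a \<Rightarrow> real) \<Rightarrow> 'a \<Rightarrow> real" where
  "partial b f x = frechet_derivative f (at x) b"

definition grad :: "('a::euclidean_space \<Rightarrow> real) \<Rightarrow> 'a \<Rightarrow> 'a" where
  "grad f x = (\<Sum>b\<in>Basis. partial b f x *\<^sub>R b)"

definition laplacian :: "('a::euclidean_space \<Rightarrow> real) \<Rightarrow> 'a \<Rightarrow> real" where
  "laplacian f x = (\<Sum>b\<in>Basis. partial b (partial b f) x)"

fun Ck_on :: "nat \<Rightarrow> 'a::euclidean_space set \<Rightarrow> ('a \<Rightarrow> real) \<Rightarrow> bool" where
  "Ck_on 0 S f = continuous_on S f"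
| "Ck_on (Suc k) S f =
     ((\<forall>x\<in>S. f differentiable (at x)) \<and> (\<forall>b\<in>Basis. Ck_on k S (partial b f)))"

definition smooth_on :: "'a::euclidean_space set \<Rightarrow> ('a \<Rightarrow> real) \<Rightarrow> bool" where
  "smooth_on S f \<longleftrightarrow> (\<forall>k. Ck_on k S f)"

text \<open>Near the boundary point \<open>x\<close>, the set \<open>\<Omega>\<close> is the sublevel set of a smooth function \<open>\<psi>\<close>
  with nonvanishing gradient; \<open>grad \<psi> x\<close> is then an outward normal vector at \<open>x\<close>.\<close>

definition local_defining_function ::
    "'a::euclidean_space set \<Rightarrow> 'a \<Rightarrow> 'a set \<Rightarrow> ('a \<Rightarrow> real) \<Rightarrow> bool" where
  "local_defining_function \<Omega> x U \<psi> \<longleftrightarrow>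
     open U \<and> x \<in> U \<and> smooth_on U \<psi> \<and> grad \<psi> x \<noteq> 0 \<and> \<Omega> \<inter> U = {y \<in> U. \<psi> y < 0}"

definition smooth_bounded_domain :: "'a::euclidean_space set \<Rightarrow> bool" where
  "smooth_bounded_domain \<Omega> \<longleftrightarrow>
     open \<Omega> \<and> connected \<Omega> \<and> bounded \<Omega> \<and> \<Omega> \<noteq> {} \<and>
     (\<forall>x\<in>frontier \<Omega>. \<exists>U \<psi>. local_defining_function \<Omega> x U \<psi>)"

definition outward_unit_normal :: "'a::euclidean_space set \<Rightarrow> 'a \<Rightarrow> 'a \<Rightarrow> bool" where
  "outward_unit_normal \<Omega> x n \<longleftrightarrow>
     (\<exists>U \<psi>. local_defining_function \<Omega> x U \<psi> \<and> n = grad \<psi> x /\<^sub>R norm (grad \<psi> x))"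

definition trap_density :: "'a::euclidean_space set \<Rightarrow> ('a \<Rightarrow> real) \<Rightarrow> bool" where
  "trap_density \<Omega> \<rho> \<longleftrightarrow>
     integrable (lebesgue_on \<Omega>) \<rho> \<and> (AE x in lebesgue_on \<Omega>. 0 \<le> \<rho> x) \<and>
     (LINT x|lebesgue_on \<Omega>. \<rho> x) = 1"

text \<open>Classical solutions of \<open>\<Delta>u - \<kappa> \<rho> u = - M\<close> in \<open>\<Omega>\<close>, \<open>\<partial>\<^sub>n u = 0\<close> on the boundary: \<open>u\<close> is
  \<open>C\<^sup>2\<close> in \<open>\<Omega>\<close> and \<open>C\<^sup>1\<close> up to the boundary, where \<open>G\<close> is the continuous extension of its gradient.
  As \<open>\<rho>\<close> is only determined up to null sets, the equation is required almost everywhere; for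
  continuous \<open>\<rho>\<close> and \<open>M\<close> this is the same as everywhere in \<open>\<Omega>\<close>.\<close>

definition classical_solution ::
    "'a::euclidean_space set \<Rightarrow> real \<Rightarrow> ('a \<Rightarrow> real) \<Rightarrow> ('a \<Rightarrow> real) \<Rightarrow> ('a \<Rightarrow> real) \<Rightarrow> bool" where
  "classical_solution \<Omega> \<kappa> M \<rho> u \<longleftrightarrow>
     Ck_on 2 \<Omega> u \<and> continuous_on (closure \<Omega>) u \<and>
     (AE x in lebesgue_on \<Omega>. laplacian u x - \<kappa> * \<rho> x * u x = - M x) \<and>
     (\<exists>G. continuous_on (closure \<Omega>) G \<and> (\<forall>x\<in>\<Omega>. G x = grad u x) \<and>
          (\<forall>x\<in>frontier \<Omega>. \<forall>n. outward_unit_normal \<Omega> x n \<longrightarrow> G x \<bullet> n = 0))"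

definition test_function :: "'a::euclidean_space set \<Rightarrow> ('a \<Rightarrow> real) \<Rightarrow> bool" where
  "test_function \<Omega> \<phi> \<longleftrightarrow>
     smooth_on UNIV \<phi> \<and> compact (closure {x. \<phi> x \<noteq> 0}) \<and> closure {x. \<phi> x \<noteq> 0} \<subseteq> \<Omega>"

text \<open>\<open>H1_function \<Omega> f g\<close>: \<open>f\<close> lies in the Sobolev space \<open>H\<^sup>1\<close> of \<open>\<Omega>\<close> and \<open>g\<close> is its weak gradient.\<close>

definition H1_function ::
    "'a::euclidean_space set \<Rightarrow> ('a \<Rightarrow> real) \<Rightarrow> ('a \<Rightarrow> 'a) \<Rightarrow> bool" where
  "H1_function \<Omega> f g \<longleftrightarrow>
     f \<in> borel_measurable (lebesgue_on \<Omega>) \<and> integrable (lebesgue_on \<Omega>) (\<lambda>x. (f x)\<^sup>2) \<and>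
     g \<in> borel_measurable (lebesgue_on \<Omega>) \<and> integrable (lebesgue_on \<Omega>) (\<lambda>x. (norm (g x))\<^sup>2) \<and>
     (\<forall>\<phi>. test_function \<Omega> \<phi> \<longrightarrow>
        (LINT x|lebesgue_on \<Omega>. f x *\<^sub>R grad \<phi> x) = - (LINT x|lebesgue_on \<Omega>. \<phi> x *\<^sub>R g x))"

text \<open>The energy space of the boundary value problem, \<open>H\<^sup>1(\<Omega>) \<inter> L\<^sup>2(\<rho> dx)\<close>. The condition on
  \<open>M * f\<close> makes the right-hand side of the weak formulation meaningful; it holds automatically
  if \<open>M\<close> is bounded.\<close>

definition energy_function ::
    "'a::euclidean_space set \<Rightarrow> ('a \<Rightarrow> real) \<Rightarrow> ('a \<Rightarrow> real) \<Rightarrow> ('a \<Rightarrow> real) \<Rightarrow> ('a \<Rightarrow> 'a) \<Rightarrow> bool" where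
  "energy_function \<Omega> M \<rho> f g \<longleftrightarrow>
     H1_function \<Omega> f g \<and> integrable (lebesgue_on \<Omega>) (\<lambda>x. \<rho> x * (f x)\<^sup>2) \<and>
     integrable (lebesgue_on \<Omega>) (\<lambda>x. M x * f x)"

text \<open>Variational solutions; the homogeneous Neumann condition is the natural boundary condition,
  encoded by test functions that need not vanish on the boundary.\<close>

definition weak_solution ::
    "'a::euclidean_space set \<Rightarrow> real \<Rightarrow> ('a \<Rightarrow> real) \<Rightarrow> ('a \<Rightarrow> real) \<Rightarrow> ('a \<Rightarrow> real) \<Rightarrow> bool" where
  "weak_solution \<Omega> \<kappa> M \<rho> u \<longleftrightarrow>
     (\<exists>g. energy_function \<Omega> M \<rho> u g \<and>
        (\<forall>\<phi> h. energy_function \<Omega> M \<rho> \<phi> h \<longrightarrow>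
           (LINT x|lebesgue_on \<Omega>. g x \<bullet> h x) + \<kappa> * (LINT x|lebesgue_on \<Omega>. \<rho> x * u x * \<phi> x)
             = (LINT x|lebesgue_on \<Omega>. M x * \<phi> x)))"

text \<open>A trap density may be discontinuous, and then the problem has no classical solution in
  general; so both classical and variational solutions are admitted.\<close>

definition mfpt_solution ::
    "'a::euclidean_space set \<Rightarrow> real \<Rightarrow> ('a \<Rightarrow> real) \<Rightarrow> ('a \<Rightarrow> real) \<Rightarrow> ('a \<Rightarrow> real) \<Rightarrow> bool" where
  "mfpt_solution \<Omega> \<kappa> M \<rho> u \<longleftrightarrow> classical_solution \<Omega> \<kappa> M \<rho> u \<or> weak_solution \<Omega> \<kappa> M \<rho> u"

definition mean_capture_time ::
    "'a::euclidean_space set \<Rightarrow> ('a \<Rightarrow> real) \<Rightarrow> ('a \<Rightarrow> real) \<Rightarrow> real" where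
  "mean_capture_time \<Omega> \<mu> u = (LINT x|lebesgue_on \<Omega>. \<mu> x * u x)"

end

theory Submission
  imports Defs "HOL-Real_Asymp.Real_Asymp"
begin

text \<open>Testing the equation with \<open>1\<close> gives \<open>\<kappa> \<integral> \<rho> u = |M|\<close>, testing it with \<open>u\<close> gives
  \<open>\<integral> |\<nabla>u|\<^sup>2 + \<kappa> \<integral> \<rho> u\<^sup>2 = \<integral> M u\<close>. As \<open>\<rho>\<close> is a probability density, Jensen's inequality yields
  \<open>\<integral> M u \<ge> \<kappa> (\<integral> \<rho> u)\<^sup>2 = |M|\<^sup>2 / \<kappa>\<close>. Equality forces \<open>\<nabla>u = 0\<close> and \<open>\<rho> u = \<rho> |M| / \<kappa>\<close> almost
  everywhere, and testing with compactly supported functions turns this into \<open>\<rho> = M / |M|\<close>. For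
  classical solutions the two identities need the divergence theorem, but only for fields tangential
  to the boundary, so that no surface integral occurs: it is enough to cut the field off near the
  boundary.\<close>

section \<open>Integration by parts for compact support\<close>

text \<open>A classical solution is not turned into a variational one: that would mean testing with
  every function of the energy space, unbounded ones included. Only 1, u and C^1 functions of
  compact support are ever used as test functions, and \<open>energy_balance\<close> records the
  identities that they give; both notions of solution meet there. The obstacle is low regularity.
  \<rho> and M are merely integrable, so the second derivatives of u may be unbounded near the
  boundary; the Laplacian is integrable only through the equation itself. Limits may therefore
  involve the divergence of a field, never its full derivative. The field is just continuous up to
  the boundary, which is exactly enough: a normal component of size o(1), times a cut-off gradient
  of size 1 / \<delta>, times a strip of measure O(\<delta>), still tends to 0. At \<rho> = \<mu> no
  uniqueness theory is invoked: every solution attains equality there, and \<mu> > 0 turns \<mu> (u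
  - c)^2 = 0 into u = c with c = |M| / \<kappa>.\<close>

lemma has_derivative_zero_outside:
  fixes f :: "'a::euclidean_space \<Rightarrow> real"
  assumes "open S" "x \<in> S" "\<And>y. y \<in> S \<Longrightarrow> f y = 0"
    and "(f has_derivative (\<lambda>v. h \<bullet> v)) (at x)"
  shows "h = 0"
proof -
  have "((\<lambda>x. 0) has_derivative (\<lambda>v. h \<bullet> v)) (at x)"
    by (rule has_derivative_transform_within_open[OF assms(4,1,2)]) (use assms(3) in auto)
  then have "(\<lambda>v. h \<bullet> v) = (\<lambda>v. 0)"
    by (rule has_derivative_unique[OF _ has_derivative_const])
  then have "h \<bullet> h = 0" by metis
  then show ?thesis by simp
qed

text \<open>A single sequence of steps, 1 / (n + 1), because dominated convergence will be applied
  to it.\<close>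

lemma has_derivative_imp_difference_quotient:
  fixes f :: "'a::euclidean_space \<Rightarrow> real"
  assumes "(f has_derivative f') (at x)"
  shows "(\<lambda>n. real (Suc n) * (f (x + v /\<^sub>R real (Suc n)) - f x)) \<longlonglongrightarrow> f' v"
proof -
  have "((\<lambda>t. x + t *\<^sub>R v) has_derivative (\<lambda>t. t *\<^sub>R v)) (at 0)"
    by (auto intro!: derivative_eq_intros)
  then have "((\<lambda>t. f (x + t *\<^sub>R v)) has_derivative (\<lambda>t. f' (t *\<^sub>R v))) (at 0)"
    by (rule has_derivative_compose) (use assms in simp)
  moreover have "(\<lambda>t. f' (t *\<^sub>R v)) = (*) (f' v)"
    using linear_scale[OF has_derivative_linear[OF assms]] by (simp add: fun_eq_iff)
  ultimately have "((\<lambda>t. f (x + t *\<^sub>R v)) has_field_derivative f' v) (at 0)"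
    by (simp add: has_field_derivative_def)
  then have "((\<lambda>t. (f (x + t *\<^sub>R v) - f x) / t) \<longlongrightarrow> f' v) (at 0)"
    by (simp add: DERIV_def)
  moreover have "filterlim (\<lambda>n. inverse (real (Suc n))) (at 0) sequentially"
    by (intro filterlim_atI LIMSEQ_inverse_real_of_nat) auto
  ultimately have "((\<lambda>n. (f (x + inverse (real (Suc n)) *\<^sub>R v) - f x) / inverse (real (Suc n))) \<longlonglongrightarrow> f' v)"
    by (rule filterlim_compose)
  then show ?thesis by (simp add: field_simps)
qed

lemma integral_translation:
  fixes f :: "'a::euclidean_space \<Rightarrow> real"
  assumes [measurable]: "f \<in> borel_measurable borel"
  shows "integral\<^sup>L lborel (\<lambda>x. f (x + v)) = integral\<^sup>L lborel f"
proof -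
  have "integral\<^sup>L lborel f = integral\<^sup>L (distr lborel borel ((+) v)) f"
    by (simp add: lborel_distr_plus)
  also have "\<dots> = integral\<^sup>L lborel (\<lambda>x. f (v + x))"
    by (rule integral_distr) auto
  finally show ?thesis by (simp add: add.commute)
qed

text \<open>The integral of a difference quotient vanishes by translation invariance; pass to the limit.\<close>

lemma integral_gradient_zero:
  fixes f :: "'a::euclidean_space \<Rightarrow> real" and h :: "'a \<Rightarrow> 'a"
  assumes deriv: "\<And>x. (f has_derivative (\<lambda>v. h x \<bullet> v)) (at x)"
    and cont: "continuous_on UNIV h"
    and K: "compact K" "\<And>x. x \<notin> K \<Longrightarrow> f x = 0"
  shows "integrable lborel h" "integral\<^sup>L lborel h = 0"
proof -
  have h0: "h x = 0" if "x \<notin> K" for x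
    by (rule has_derivative_zero_outside[of "- K" x f])
      (use that deriv K in \<open>auto simp: compact_imp_closed\<close>)
  have h_ind: "h = (\<lambda>x. indicator K x *\<^sub>R h x)"
    by (auto simp: indicator_def fun_eq_iff h0)
  show int_h: "integrable lborel h"
    by (subst h_ind) (rule borel_integrable_compact[OF K(1) continuous_on_subset[OF cont]], simp)
  have "bounded (h ` K)"
    by (intro compact_imp_bounded compact_continuous_image K continuous_on_subset[OF cont]) auto
  then obtain C where C: "0 < C" "\<And>x. x \<in> K \<Longrightarrow> norm (h x) \<le> C"
    by (auto simp: bounded_pos)
  have hC: "norm (h x) \<le> C" for x
    using C h0 by (cases "x \<in> K") auto
  \<comment> \<open>A global bound on the gradient makes f Lipschitz on the whole, convex space,
    with one constant for all difference quotients.\<close>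
  have "onorm (\<lambda>v. h x \<bullet> v) \<le> C" for x
    by (intro onorm_le order_trans[OF Cauchy_Schwarz_ineq2[folded real_norm_def]] mult_right_mono hC norm_ge_zero)
  then have lip: "norm (f y - f x) \<le> C * norm (y - x)" for x y
    by (intro differentiable_bound[of UNIV f "\<lambda>x v. h x \<bullet> v"])
      (auto intro: has_derivative_at_withinI deriv)
  have contf: "continuous_on UNIV f"
    using deriv by (meson continuous_at_imp_continuous_on has_derivative_continuous)
  then have [measurable]: "f \<in> borel_measurable borel"
    by (rule borel_measurable_continuous_onI)
  have [measurable]: "h \<in> borel_measurable borel"
    by (rule borel_measurable_continuous_onI[OF cont])
  obtain R where R: "0 < R" "\<And>x. x \<in> K \<Longrightarrow> norm x \<le> R"
    using compact_imp_bounded[OF K(1)] bounded_pos by metis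
  have int_f: "integrable lborel f"
  proof -
    have "f = (\<lambda>x. indicator K x *\<^sub>R f x)"
      by (auto simp: indicator_def fun_eq_iff K)
    then show ?thesis
      using borel_integrable_compact[OF K(1) continuous_on_subset[OF contf]] by simp
  qed
  have "integral\<^sup>L lborel h \<bullet> v = 0" for v
  proof -
    define s where "s = (\<lambda>n x. real (Suc n) * (f (x + v /\<^sub>R real (Suc n)) - f x))"
    \<comment> \<open>Steps have length at most |v|, so every quotient vanishes outside the ball of
      radius R + |v|; inside, the Lipschitz bound gives C |v|.\<close>
    define B where "B = (\<lambda>x::'a. indicator (cball 0 (R + norm v)) x *\<^sub>R (C * norm v))"
    have "(\<lambda>n. integral\<^sup>L lborel (s n)) \<longlonglongrightarrow> integral\<^sup>L lborel (\<lambda>x. h x \<bullet> v)"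
    proof (rule integral_dominated_convergence[where w = B])
      show "integrable lborel B"
        unfolding B_def by (rule borel_integrable_compact) auto
      show "AE x in lborel. (\<lambda>n. s n x) \<longlonglongrightarrow> h x \<bullet> v"
        unfolding s_def by (intro AE_I2 has_derivative_imp_difference_quotient[OF deriv])
      show "AE x in lborel. norm (s n x) \<le> B x" for n
      proof (intro AE_I2)
        fix x
        let ?y = "x + v /\<^sub>R real (Suc n)"
        have nv: "norm (v /\<^sub>R real (Suc n)) \<le> norm v"
          by (simp add: field_simps)
        show "norm (s n x) \<le> B x"
        proof (cases "x \<in> cball 0 (R + norm v)")
          case True
          have "norm (f ?y - f x) \<le> C * norm (?y - x)" by (rule lip)
          then have "real (Suc n) * norm (f ?y - f x) \<le> real (Suc n) * (C * (norm v / real (Suc n)))"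
            by (intro mult_left_mono) (auto simp: divide_inverse mult.commute)
          then show ?thesis using True
            by (simp add: s_def B_def abs_mult)
        next
          case False
          then have "norm x > R + norm v" by simp
          then have "x \<notin> K" using R(2)[of x] norm_ge_zero[of v] by linarith
          moreover have "?y \<notin> K"
          proof
            assume "?y \<in> K"
            then have "norm ?y \<le> R" by (rule R)
            moreover have "norm x \<le> norm ?y + norm (v /\<^sub>R real (Suc n))"
              using norm_triangle_ineq4[of ?y "v /\<^sub>R real (Suc n)"] by simp
            ultimately show False using nv \<open>norm x > R + norm v\<close> by linarith
          qed
          ultimately show ?thesis using K False by (simp add: s_def B_def)
        qed
      qed
    qed (auto simp: s_def B_def)
    moreover have "integral\<^sup>L lborel (s n) = 0" for n
    proof -
      have "integrable lborel (\<lambda>x. f (x + v /\<^sub>R real (Suc n)))"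
      proof -
        have "integrable (distr lborel borel ((+) (v /\<^sub>R real (Suc n)))) f"
          using int_f by (simp add: lborel_distr_plus)
        then show ?thesis
          by (subst (asm) integrable_distr_eq) (auto simp: add.commute)
      qed
      then show ?thesis
        using int_f integral_translation[of f "v /\<^sub>R real (Suc n)"] by (simp add: s_def)
    qed
    ultimately have "integral\<^sup>L lborel (\<lambda>x. h x \<bullet> v) = 0"
      by (simp add: LIMSEQ_const_iff)
    then show ?thesis using int_h by (simp add: integral_inner_left)
  qed
  then show "integral\<^sup>L lborel h = 0"
    by (metis inner_eq_zero_iff)
qed

text \<open>Passes between the whole space, where translation invariance lives, and the
  domain.\<close>

lemma integral_lebesgue_on_eq_lborel:
  fixes f :: "'a::euclidean_space \<Rightarrow> 'b::{banach, second_countable_topology}"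
  assumes "open S" "f \<in> borel_measurable borel" "\<And>x. x \<notin> S \<Longrightarrow> f x = 0"
  shows "integrable (lebesgue_on S) f \<longleftrightarrow> integrable lborel f"
    "integral\<^sup>L (lebesgue_on S) f = integral\<^sup>L lborel f"
proof -
  have *: "(\<lambda>x. indicator S x *\<^sub>R f x) = f"
    using assms(3) by (auto simp: indicator_def fun_eq_iff)
  show "integrable (lebesgue_on S) f \<longleftrightarrow> integrable lborel f"
    using assms by (subst integrable_restrict_space) (auto simp: * integrable_completion)
  show "integral\<^sup>L (lebesgue_on S) f = integral\<^sup>L lborel f"
    using assms by (subst integral_restrict_space) (auto simp: * integral_completion)
qed

text \<open>Each component of F, extended by zero, is C^1 on the whole space, since the open sets S
  and the complement of K cover it and F vanishes on their overlap. The divergence is then a sum of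
  partial derivatives of compactly supported functions, each of integral zero.\<close>

lemma divergence_compact_support:
  fixes F :: "'a::euclidean_space \<Rightarrow> 'a"
  assumes S: "open S"
    and deriv: "\<And>x. x \<in> S \<Longrightarrow> (F has_derivative F' x) (at x)"
    and cont: "\<And>v. continuous_on S (\<lambda>x. F' x v)"
    and K: "compact K" "K \<subseteq> S" "\<And>x. x \<in> S - K \<Longrightarrow> F x = 0"
  shows "integral\<^sup>L (lebesgue_on S) (\<lambda>x. \<Sum>b\<in>Basis. F' x b \<bullet> b) = 0"
    "integrable (lebesgue_on S) (\<lambda>x. \<Sum>b\<in>Basis. F' x b \<bullet> b)"
proof -
  define f where "f = (\<lambda>b x. if x \<in> S then F x \<bullet> b else 0)"
  \<comment> \<open>The gradient of the component F . b, a row of the Jacobian, in the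
    representation that \<open>integral_gradient_zero\<close> expects.\<close>
  define h where "h = (\<lambda>b x. if x \<in> S then (\<Sum>i\<in>Basis. (F' x i \<bullet> b) *\<^sub>R i) else 0)"
  have clK: "closed K" using K compact_imp_closed by blast
  have lin: "linear (F' x)" if "x \<in> S" for x
    using deriv[OF that] has_derivative_linear by blast
  have F'v: "F' x v \<bullet> b = h b x \<bullet> v" if "x \<in> S" for x v b
  proof -
    have "F' x v = F' x (\<Sum>i\<in>Basis. (v \<bullet> i) *\<^sub>R i)"
      by (simp add: euclidean_representation)
    also have "\<dots> = (\<Sum>i\<in>Basis. (v \<bullet> i) *\<^sub>R F' x i)"
      by (simp add: linear_sum[OF lin[OF that]] linear_scale[OF lin[OF that]])
    finally show ?thesis
      using that by (simp add: h_def inner_sum_left inner_sum_right inner_commute mult.commute)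
  qed
  have S_deriv: "((\<lambda>x. F x \<bullet> b) has_derivative (\<lambda>v. h b x \<bullet> v)) (at x)" if "x \<in> S" for x b
  proof -
    have "((\<lambda>x. F x \<bullet> b) has_derivative (\<lambda>v. F' x v \<bullet> b)) (at x)"
      by (rule has_derivative_inner_left[OF deriv[OF that]])
    then show ?thesis by (simp add: F'v[OF that])
  qed
  have h0: "h b x = 0" if "x \<notin> K" for b x
  proof (cases "x \<in> S")
    case True
    show ?thesis
      by (rule has_derivative_zero_outside[of "S - K" x "\<lambda>x. F x \<bullet> b"])
        (use True that S clK K S_deriv in auto)
  qed (simp add: h_def)
  have fd: "(f b has_derivative (\<lambda>v. h b x \<bullet> v)) (at x)" for b x
  proof (cases "x \<in> S")
    case True
    show ?thesis
      by (rule has_derivative_transform_within_open[OF S_deriv[OF True] S True]) (simp add: f_def)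
  next
    case False
    then have "x \<notin> K" using K by auto
    have "((\<lambda>x. 0) has_derivative (\<lambda>v. h b x \<bullet> v)) (at x)"
      by (simp add: h0[OF \<open>x \<notin> K\<close>])
    then show ?thesis
      by (rule has_derivative_transform_within_open[where s = "- K"])
        (use \<open>x \<notin> K\<close> clK K in \<open>auto simp: f_def\<close>)
  qed
  have ch: "continuous_on UNIV (h b)" for b
  proof -
    have "continuous_on S (h b)"
      unfolding h_def
      by (rule continuous_on_cong[THEN iffD1, OF refl, of _ "\<lambda>x. \<Sum>i\<in>Basis. (F' x i \<bullet> b) *\<^sub>R i"])
        (auto intro!: continuous_intros cont)
    moreover have "continuous_on (- K) (h b)"
      by (rule continuous_on_cong[THEN iffD1, OF refl _ continuous_on_const[of _ 0]]) (simp add: h0)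
    ultimately have "continuous_on (S \<union> - K) (h b)"
      by (intro continuous_on_open_Un) (use S clK in auto)
    moreover have "S \<union> - K = UNIV" using K by auto
    ultimately show ?thesis by simp
  qed
  have "f b x = 0" if "x \<notin> K" for b x
    using K that by (auto simp: f_def)
  then have int: "integrable lborel (h b)" "integral\<^sup>L lborel (h b) = 0" for b
    using integral_gradient_zero[OF fd ch K(1)] by auto
  have meas: "h b \<in> borel_measurable borel" for b
    by (rule borel_measurable_continuous_onI[OF ch])
  have hS: "h b x = 0" if "x \<notin> S" for b x using that by (simp add: h_def)
  have intS: "integrable (lebesgue_on S) (h b)" "integral\<^sup>L (lebesgue_on S) (h b) = 0" for b
    using int integral_lebesgue_on_eq_lborel[OF S meas hS, of b] by auto
  have eq: "(\<Sum>b\<in>Basis. F' x b \<bullet> b) = (\<Sum>b\<in>Basis. h b x \<bullet> b)" if "x \<in> S" for x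
    using F'v[OF that] by simp
  have "integral\<^sup>L (lebesgue_on S) (\<lambda>x. \<Sum>b\<in>Basis. F' x b \<bullet> b) = integral\<^sup>L (lebesgue_on S) (\<lambda>x. \<Sum>b\<in>Basis. h b x \<bullet> b)"
    by (rule Bochner_Integration.integral_cong) (auto simp: eq)
  also have "\<dots> = 0"
    using intS by (simp add: integral_sum)
  finally show "integral\<^sup>L (lebesgue_on S) (\<lambda>x. \<Sum>b\<in>Basis. F' x b \<bullet> b) = 0" .
  have "integrable (lebesgue_on S) (\<lambda>x. \<Sum>b\<in>Basis. h b x \<bullet> b)"
    using intS by auto
  then show "integrable (lebesgue_on S) (\<lambda>x. \<Sum>b\<in>Basis. F' x b \<bullet> b)"
    by (rule Bochner_Integration.integrable_cong[THEN iffD1, rotated -1]) (auto simp: eq)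
qed

section \<open>The divergence theorem for tangential fields\<close>

lemma differentiable_has_derivative_grad:
  assumes "f differentiable (at x)"
  shows "(f has_derivative (\<lambda>v. grad f x \<bullet> v)) (at x)"
proof -
  let ?D = "frechet_derivative f (at x)"
  have D: "(f has_derivative ?D) (at x)"
    using assms frechet_derivative_works by blast
  have "?D v = grad f x \<bullet> v" for v
  proof -
    have "?D v = ?D (\<Sum>b\<in>Basis. (v \<bullet> b) *\<^sub>R b)"
      by (simp add: euclidean_representation)
    also have "\<dots> = (\<Sum>b\<in>Basis. (v \<bullet> b) * ?D b)"
      using has_derivative_linear[OF D] by (simp add: linear_sum linear_scale)
    finally show ?thesis
      by (simp add: grad_def partial_def inner_sum_left inner_commute[of v] mult.commute)
  qed
  then show ?thesis using D by (metis (no_types, lifting) ext)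
qed

lemma has_derivative_imp_grad_eq:
  assumes "(f has_derivative (\<lambda>v. h \<bullet> v)) (at x)"
  shows "grad f x = h"
  using frechet_derivative_at[OF assms, symmetric]
  by (simp add: grad_def partial_def euclidean_representation)

lemma Ck_on_1_continuous_grad:
  assumes "Ck_on 1 S f"
  shows "continuous_on S (grad f)"
  using assms unfolding grad_def by (auto intro!: continuous_intros)

lemma smooth_on_imp_grad:
  assumes "smooth_on S f"
  shows "continuous_on S (grad f)"
    "x \<in> S \<Longrightarrow> (f has_derivative (\<lambda>v. grad f x \<bullet> v)) (at x)"
proof -
  have "Ck_on 1 S f" using assms by (simp add: smooth_on_def)
  then show "continuous_on S (grad f)"
    "x \<in> S \<Longrightarrow> (f has_derivative (\<lambda>v. grad f x \<bullet> v)) (at x)"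
    by (auto intro: differentiable_has_derivative_grad Ck_on_1_continuous_grad)
qed

section \<open>A cut-off profile on the real line\<close>

lemma has_field_derivative_max_0_power2:
  "((\<lambda>t::real. (max 0 t)\<^sup>2) has_field_derivative 2 * max 0 t) (at t)"
proof -
  consider "t > 0" | "t < 0" | "t = 0" by linarith
  then show ?thesis
  proof cases
    case 1
    have "((\<lambda>t::real. t\<^sup>2) has_field_derivative 2 * max 0 t) (at t)"
      using 1 by (auto intro!: derivative_eq_intros)
    then show ?thesis
      by (rule has_field_derivative_transform_within_open[where S = "{0<..}"]) (use 1 in auto)
  next
    case 2
    have "((\<lambda>t::real. 0) has_field_derivative 2 * max 0 t) (at t)"
      using 2 by (auto intro!: derivative_eq_intros)
    then show ?thesis
      by (rule has_field_derivative_transform_within_open[where S = "{..<0}"]) (use 2 in auto)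
  next
    case 3
    have "((\<lambda>h::real. max 0 h) \<longlongrightarrow> max 0 0) (at 0)"
      by (intro tendsto_intros)
    moreover have "(max 0 h)\<^sup>2 / h = max 0 h" for h :: real
      by (simp add: max_def power2_eq_square)
    ultimately have "((\<lambda>h::real. (max 0 h)\<^sup>2 / h) \<longlongrightarrow> 0) (at 0)"
      by simp
    then show ?thesis using 3 by (simp add: DERIV_def)
  qed
qed

text \<open>The quotient q t / (q t + q (1 - t)), with q the squared positive part, interpolates
  between 0 and 1. Being C^1 suffices because just the gradient of the cut-off occurs.\<close>

lemma C1_step_function:
  obtains \<eta> \<eta>' :: "real \<Rightarrow> real" and C :: real
  where "\<forall>t. (\<eta> has_field_derivative \<eta>' t) (at t)" "continuous_on UNIV \<eta>'"
    "\<forall>t\<le>0. \<eta> t = 0" "\<forall>t\<ge>1. \<eta> t = 1" "\<forall>t. 0 \<le> \<eta> t" "\<forall>t. \<eta> t \<le> 1"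
    "\<forall>t\<ge>1. \<eta>' t = 0" "\<forall>t. \<bar>\<eta>' t\<bar> \<le> C" "0 < C"
proof -
  define q :: "real \<Rightarrow> real" where "q = (\<lambda>t. (max 0 t)\<^sup>2)"
  define q' :: "real \<Rightarrow> real" where "q' = (\<lambda>t. 2 * max 0 t)"
  define \<eta> where "\<eta> = (\<lambda>t. q t / (q t + q (1 - t)))"
  define \<eta>' where "\<eta>' = (\<lambda>t. (q' t * (q t + q (1 - t)) - q t * (q' t - q' (1 - t))) / (q t + q (1 - t))\<^sup>2)"
  have q[derivative_intros]: "(q has_field_derivative q' t) (at t)" for t
    unfolding q_def q'_def by (rule has_field_derivative_max_0_power2)
  have q2: "((\<lambda>t. q (1 - t)) has_field_derivative - q' (1 - t)) (at t)" for t
  proof -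
    have "((\<lambda>t. 1 - t) has_field_derivative - 1) (at t)"
      by (auto intro!: derivative_eq_intros)
    from DERIV_chain2[OF q this] show ?thesis by simp
  qed
  \<comment> \<open>t and 1 - t cannot both be nonpositive.\<close>
  have pos: "q t + q (1 - t) > 0" for t
    by (cases "t > 0") (auto simp: q_def max_def intro: add_pos_nonneg add_nonneg_pos)
  have q0: "0 \<le> q t" for t by (simp add: q_def)
  have der: "(\<eta> has_field_derivative \<eta>' t) (at t)" for t
    unfolding \<eta>_def \<eta>'_def using pos[of t]
    by (auto intro!: derivative_eq_intros q2 simp: power2_eq_square)
  have nz: "(q t + q (1 - t))\<^sup>2 \<noteq> 0" for t
    using pos[of t] by simp
  have cq: "continuous_on UNIV q" "continuous_on UNIV q'"
    "continuous_on UNIV (\<lambda>t. q (1 - t))" "continuous_on UNIV (\<lambda>t. q' (1 - t))"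
    unfolding q_def q'_def by (auto intro!: continuous_intros)
  have cont: "continuous_on UNIV \<eta>'"
    unfolding \<eta>'_def
    by (intro continuous_on_divide continuous_on_mult continuous_on_add continuous_on_diff
        continuous_on_power cq ballI nz)
  have "bounded (\<eta>' ` {0..1})"
    by (intro compact_imp_bounded compact_continuous_image continuous_on_subset[OF cont]) auto
  then obtain C where C: "0 < C" "\<And>t. t \<in> {0..1} \<Longrightarrow> \<bar>\<eta>' t\<bar> \<le> C"
    by (auto simp: bounded_pos)
  have z1: "\<eta>' t = 0" if "1 \<le> t" for t
    using that by (simp add: \<eta>'_def q_def q'_def)
  have z0: "\<eta>' t = 0" if "t \<le> 0" for t
    using that by (simp add: \<eta>'_def q_def q'_def)
  have "\<bar>\<eta>' t\<bar> \<le> C" for t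
    using C z1[of t] z0[of t] by (cases "t \<in> {0..1}") auto
  moreover have "\<eta> t = 1" if "1 \<le> t" for t
    using that by (simp add: \<eta>_def q_def)
  moreover have "\<eta> t = 0" if "t \<le> 0" for t
    using that by (simp add: \<eta>_def q_def)
  moreover have "0 \<le> \<eta> t" "\<eta> t \<le> 1" for t
    using q0[of t] q0[of "1 - t"] pos[of t] by (auto simp: \<eta>_def)
  ultimately show ?thesis
    using that der cont z0 z1 C(1) by blast
qed

section \<open>Thin strips along the boundary and the local divergence theorem\<close>

text \<open>The translates \<open>S + (k r / n) v\<close> for \<open>k < n\<close> are disjoint and lie in the ball of radius
  \<open>2 r\<close>.\<close>

lemma measure_thin_set:
  fixes S :: "'a::euclidean_space set"
  assumes S: "S \<in> lmeasurable" "S \<subseteq> ball p r"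
    and v: "norm v = 1" and r: "0 < r" and n: "0 < n"
    and sep: "\<And>x t. x \<in> S \<Longrightarrow> x + t *\<^sub>R v \<in> S \<Longrightarrow> t < r / real n"
  shows "real n * measure lebesgue S \<le> measure lebesgue (ball p (2 * r))"
proof -
  define T where "T = (\<lambda>k. (+) ((real k * r / real n) *\<^sub>R v) ` S)"
  have T: "T k \<in> lmeasurable" for k
    unfolding T_def by (rule measurable_translation[OF S(1)])
  have less: "disjnt (T i) (T j)" if "i < j" for i j
  proof (rule ccontr)
    assume "\<not> disjnt (T i) (T j)"
    then obtain x y where xy: "x \<in> S" "y \<in> S"
      "(real i * r / real n) *\<^sub>R v + x = (real j * r / real n) *\<^sub>R v + y"
      by (auto simp: disjnt_def T_def)
    \<comment> \<open>A common point makes x the translate of y by (j - i) r / n, at least r / n,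
      which \<open>sep\<close> excludes.\<close>
    let ?t = "real j * r / real n - real i * r / real n"
    have "x = y + ?t *\<^sub>R v"
      unfolding scaleR_diff_left using xy(3) by (metis add.commute add_diff_cancel_left' add_diff_eq)
    then have "?t < r / real n" using sep[of y ?t] xy by simp
    moreover have "?t = real (j - i) * (r / real n)"
      unfolding of_nat_diff[OF less_imp_le[OF that]] left_diff_distrib by simp
    moreover have "1 * (r / real n) \<le> real (j - i) * (r / real n)"
      using that r by (intro mult_right_mono) auto
    ultimately show False by simp
  qed
  have disj: "pairwise (\<lambda>i j. disjnt (T i) (T j)) {..<n}"
    unfolding pairwise_def using less by (metis disjnt_sym nat_neq_iff)
  have "real n * measure lebesgue S = (\<Sum>k<n. measure lebesgue (T k))"
    by (simp add: T_def measure_translation)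
  also have "\<dots> = measure lebesgue (\<Union>k<n. T k)"
    by (rule measure_UNION'[symmetric]) (use T disj in auto)
  also have "\<dots> \<le> measure lebesgue (ball p (2 * r))"
  proof (rule measure_mono_fmeasurable)
    show "(\<Union>k<n. T k) \<subseteq> ball p (2 * r)"
    proof (clarsimp simp: T_def)
      fix k x assume k: "k < n" and x: "x \<in> S"
      have "real k * r / real n \<le> r"
        using k r n by (simp add: field_simps)
      then have "norm ((real k * r / real n) *\<^sub>R v) \<le> r"
        using v r by simp
      moreover have "dist p x < r" using S x by auto
      moreover have "dist p ((real k * r / real n) *\<^sub>R v + x) \<le> dist p x + norm ((real k * r / real n) *\<^sub>R v)"
        by (metis add.commute add_diff_cancel_left' dist_norm dist_triangle dist_commute)
      ultimately show "dist p ((real k * r / real n) *\<^sub>R v + x) < 2 * r" by linarith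
    qed
  qed (use T in auto)
  finally show ?thesis .
qed

text \<open>Integrability of the divergence is a separate demand because F' is continuous only
  inside \<Omega> and may blow up at the boundary. For the gradient of u it comes from the
  equation.\<close>

definition tangential_field ::
    "'a::euclidean_space set \<Rightarrow> ('a \<Rightarrow> 'a) \<Rightarrow> ('a \<Rightarrow> 'a \<Rightarrow> 'a) \<Rightarrow> bool" where
  "tangential_field \<Omega> F F' \<longleftrightarrow>
     continuous_on (closure \<Omega>) F \<and> (\<forall>x\<in>\<Omega>. (F has_derivative F' x) (at x)) \<and>
     (\<forall>v. continuous_on \<Omega> (\<lambda>x. F' x v)) \<and>
     (\<forall>x\<in>frontier \<Omega>. \<forall>n. outward_unit_normal \<Omega> x n \<longrightarrow> F x \<bullet> n = 0) \<and>
     integrable (lebesgue_on \<Omega>) (\<lambda>x. \<Sum>b\<in>Basis. F' x b \<bullet> b)"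

text \<open>The product rule div (s F) = s div F + grad s . F, read off the derivative of s
  F.\<close>

lemma trace_scaleR_add:
  fixes L :: "'a::euclidean_space \<Rightarrow> 'a"
  shows "(\<Sum>b\<in>Basis. (s *\<^sub>R L b + (g \<bullet> b) *\<^sub>R y) \<bullet> b) = s * (\<Sum>b\<in>Basis. L b \<bullet> b) + g \<bullet> y"
  by (simp add: inner_add_left sum.distrib sum_distrib_left euclidean_inner[of g y] mult.assoc)

text \<open>A cut-off built from a local defining function is controlled only near the boundary
  point; elsewhere the field vanishes, and this glues the two regions.\<close>

lemma continuous_on_zero_extend:
  assumes "open A" "open B" "S \<subseteq> A \<union> B" "open S"
    "continuous_on (S \<inter> A) f" "\<And>x. x \<in> S \<inter> B \<Longrightarrow> f x = 0"
  shows "continuous_on S f"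
proof -
  have "continuous_on (S \<inter> B) f"
    by (rule continuous_on_cong[THEN iffD1, OF refl _ continuous_on_const[of _ 0]]) (use assms in auto)
  then have "continuous_on (S \<inter> A \<union> S \<inter> B) f"
    by (intro continuous_on_open_Un) (use assms in auto)
  moreover have "S \<inter> A \<union> S \<inter> B = S" using assms by auto
  ultimately show ?thesis by simp
qed

text \<open>The direction v is the normalised gradient at p and c is half its norm; continuity keeps
  the slope along v above c nearby. One fixed direction replaces coordinates that flatten the
  boundary.\<close>

lemma ball_in_grad_cone:
  fixes g :: "'a::euclidean_space \<Rightarrow> 'a"
  assumes "open U" "p \<in> U" "continuous_on U g" "g p \<noteq> 0"
  obtains s v c where "0 < s" "0 < c" "norm v = 1" "ball p s \<subseteq> U" "\<forall>x\<in>ball p s. c \<le> g x \<bullet> v"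
proof -
  define v where "v = g p /\<^sub>R norm (g p)"
  define c where "c = norm (g p) / 2"
  have "continuous_on U (\<lambda>x. g x \<bullet> v)" by (intro continuous_intros assms)
  then have "open (U \<inter> (\<lambda>x. g x \<bullet> v) -` {c<..})"
    using assms(1) by (intro continuous_open_preimage) auto
  moreover have "g p \<bullet> v = norm (g p)"
    using assms(4) by (simp add: v_def power2_norm_eq_inner[symmetric] power2_eq_square field_simps)
  then have "p \<in> U \<inter> (\<lambda>x. g x \<bullet> v) -` {c<..}"
    using assms by (simp add: c_def)
  ultimately obtain s where s: "0 < s" "ball p s \<subseteq> U \<inter> (\<lambda>x. g x \<bullet> v) -` {c<..}"
    using open_contains_ball by blast
  show ?thesis
    by (rule that[of s c v]) (use s assms in \<open>auto simp: c_def v_def intro: less_imp_le\<close>)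
qed

text \<open>The mean value theorem along the segment from x to x + t v, which convexity keeps in B.
  It limits how far a strip between two levels of \<psi> extends in direction v.\<close>

lemma directional_growth:
  fixes \<psi> :: "'a::euclidean_space \<Rightarrow> real"
  assumes der: "\<And>x. x \<in> B \<Longrightarrow> (\<psi> has_derivative (\<lambda>w. g x \<bullet> w)) (at x)"
    and c: "\<And>x. x \<in> B \<Longrightarrow> c \<le> g x \<bullet> v" and B: "convex B" "x \<in> B" "x + t *\<^sub>R v \<in> B" "0 < t"
  shows "c * t \<le> \<psi> (x + t *\<^sub>R v) - \<psi> x"
proof -
  have inB: "x + s *\<^sub>R v \<in> B" if "0 \<le> s" "s \<le> t" for s
  proof -
    have "(1 - s / t) *\<^sub>R x + (s / t) *\<^sub>R (x + t *\<^sub>R v) \<in> B"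
      using B that by (intro convexD) (auto simp: field_simps)
    then show ?thesis using B(4) by (simp add: algebra_simps)
  qed
  have "((\<lambda>s. \<psi> (x + s *\<^sub>R v)) has_field_derivative g (x + s *\<^sub>R v) \<bullet> v) (at s)"
    if "0 \<le> s" "s \<le> t" for s
  proof -
    have "((\<lambda>s. x + s *\<^sub>R v) has_derivative (\<lambda>s. s *\<^sub>R v)) (at s)"
      by (auto intro!: derivative_eq_intros)
    from has_derivative_compose[OF this der[OF inB[OF that]]]
    show ?thesis
      by (simp add: has_field_derivative_def mult.commute[of _ "_ \<bullet> v"])
  qed
  from MVT2[OF B(4) this] obtain z where z: "0 < z" "z < t"
    "\<psi> (x + t *\<^sub>R v) - \<psi> (x + 0 *\<^sub>R v) = (t - 0) * (g (x + z *\<^sub>R v) \<bullet> v)"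
    by blast
  have "t * c \<le> t * (g (x + z *\<^sub>R v) \<bullet> v)"
    using B(4) z by (intro mult_left_mono c inB) auto
  then show ?thesis using z by (simp add: mult.commute)
qed

text \<open>The field is cut off in the strip \<open>-2 \<delta> < \<psi> < 0\<close>, where the cut-off function has gradient of
  size \<open>1 / \<delta>\<close>. The strip has measure of order \<open>\<delta>\<close>, and the component of the field along that gradient
  is small there because it vanishes on the boundary.\<close>

lemma divergence_near_boundary:
  fixes \<Omega> :: "'a::euclidean_space set"
  assumes \<Omega>: "open \<Omega>" "bounded \<Omega>" and ldf: "local_defining_function \<Omega> p U \<psi>"
  obtains r where "0 < r"
    "\<And>F F'. tangential_field \<Omega> F F' \<Longrightarrow> (\<And>x. x \<in> \<Omega> - ball p r \<Longrightarrow> F x = 0) \<Longrightarrow>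
      (LINT x|lebesgue_on \<Omega>. (\<Sum>b\<in>Basis. F' x b \<bullet> b)) = 0"
proof -
  define g where "g = grad \<psi>"
  have \<Omega>U: "x \<in> \<Omega> \<longleftrightarrow> \<psi> x < 0" if "x \<in> U" for x
    using ldf that by (auto simp: local_defining_function_def)
  have U: "open U" "p \<in> U" "smooth_on U \<psi>" "g p \<noteq> 0"
    using ldf by (auto simp: local_defining_function_def g_def)
  have gcont: "continuous_on U g"
    and gder: "x \<in> U \<Longrightarrow> (\<psi> has_derivative (\<lambda>v. g x \<bullet> v)) (at x)" for x
    using smooth_on_imp_grad[OF U(3)] by (auto simp: g_def)
  have \<psi>cont: "continuous_on U \<psi>"
    by (meson gder continuous_at_imp_continuous_on has_derivative_continuous)
  obtain s v c where svc: "0 < s" "0 < c" "norm v = 1" "ball p s \<subseteq> U"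
    "\<forall>x\<in>ball p s. c \<le> g x \<bullet> v"
    by (rule ball_in_grad_cone[OF U(1,2) gcont U(4)]) blast
  \<comment> \<open>Halving leaves a collar: the closed r-ball lies in the s-ball, and the s-ball
    together with the exterior of the closed r-ball covers \<Omega> by overlapping open
    sets.\<close>
  define r where "r = s / 2"
  have r: "0 < r" "cball p r \<subseteq> ball p s"
    using svc(1) by (auto simp: r_def)
  then have bs: "ball p r \<subseteq> ball p s" by auto
  from r have rU: "cball p r \<subseteq> U" using svc by blast
  have inU: "x \<in> U" if "dist p x \<le> r" for x
    using rU that by (meson mem_cball subsetD)
  have inps: "x \<in> ball p s" if "dist p x \<le> r" for x
    using r(2) that by (meson mem_cball subsetD)
  obtain \<eta> \<eta>' :: "real \<Rightarrow> real" and C where \<eta>_props: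
    "\<forall>t. (\<eta> has_field_derivative \<eta>' t) (at t)" "continuous_on UNIV \<eta>'"
    "\<forall>t\<le>0. \<eta> t = 0" "\<forall>t\<ge>1. \<eta> t = 1" "\<forall>t. 0 \<le> \<eta> t" "\<forall>t. \<eta> t \<le> 1"
    "\<forall>t\<ge>1. \<eta>' t = 0" "\<forall>t. \<bar>\<eta>' t\<bar> \<le> C" "0 < C"
    by (rule C1_step_function) blast
  note \<eta> = \<eta>_props[rule_format]
  \<comment> \<open>With 2 \<delta> n = c r / (n + 1), a rise of less than 2 \<delta> n at slope at
    least c takes a length below r / (n + 1), the spacing of n + 1 translates in
    \<open>measure_thin_set\<close>.\<close>
  define \<delta> where "\<delta> = (\<lambda>n. c * r / real (Suc n) / 2)"
  have \<delta>: "0 < \<delta> n" for n using svc r by (simp add: \<delta>_def)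
  have \<delta>2: "2 * \<delta> n = c * (r / real (Suc n))" for n by (simp add: \<delta>_def field_simps)
  have \<delta>lim: "\<delta> \<longlonglongrightarrow> 0"
  proof -
    have "(\<lambda>n. c * r / 2 * inverse (real (Suc n))) \<longlonglongrightarrow> c * r / 2 * 0"
      by (intro tendsto_mult tendsto_const LIMSEQ_inverse_real_of_nat)
    then show ?thesis by (simp add: \<delta>_def field_simps)
  qed
  \<comment> \<open>w n is 1 where \<psi> \<le> -2 \<delta> n and 0 where \<psi> \<ge> -\<delta> n.
    Its gradient is \<open>a n\<close> times g, which within \<Omega> and the r-ball vanishes off S
    n.\<close>
  define w where "w = (\<lambda>n x. \<eta> (- \<psi> x / \<delta> n - 1))"
  define a where "a = (\<lambda>n x. - \<eta>' (- \<psi> x / \<delta> n - 1) / \<delta> n)"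
  define S where "S = (\<lambda>n. {x \<in> \<Omega> \<inter> ball p r. - 2 * \<delta> n < \<psi> x})"
  have wder: "(w n has_derivative (\<lambda>v. a n x * (g x \<bullet> v))) (at x)" if "x \<in> U" for n x
  proof -
    have "((\<lambda>x. - \<psi> x / \<delta> n - 1) has_derivative (\<lambda>v. - (g x \<bullet> v) / \<delta> n)) (at x)"
      using \<delta>[of n] by (auto intro!: derivative_eq_intros gder[OF that] simp: divide_inverse)
    from has_derivative_compose[OF this \<eta>(1)[unfolded has_field_derivative_def]]
    show ?thesis by (simp add: w_def a_def)
  qed
  have wcont: "continuous_on U (w n)" for n
    by (meson wder continuous_at_imp_continuous_on has_derivative_continuous)
  have acont: "continuous_on U (a n)" for n
    unfolding a_def using \<delta>[of n]
    by (intro continuous_intros continuous_on_compose2[OF \<eta>(2)] \<psi>cont) auto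
  have Sopen: "open (S n)" for n
  proof -
    have "open ((\<Omega> \<inter> ball p r) \<inter> \<psi> -` {- 2 * \<delta> n <..})"
      using \<Omega> rU by (intro continuous_open_preimage continuous_on_subset[OF \<psi>cont]) auto
    also have "(\<Omega> \<inter> ball p r) \<inter> \<psi> -` {- 2 * \<delta> n <..} = S n" by (auto simp: S_def)
    finally show ?thesis .
  qed
  have Smeas: "S n \<in> lmeasurable" for n
    by (rule lmeasurable_open[OF _ Sopen]) (auto simp: S_def intro: bounded_subset[OF \<Omega>(2)])
  define V where "V = measure lebesgue (ball p (2 * r))"
  have SV: "measure lebesgue (S n) \<le> V / real (Suc n)" for n
  proof -
    have "real (Suc n) * measure lebesgue (S n) \<le> V"
      unfolding V_def
    proof (rule measure_thin_set[OF Smeas _ svc(3) r(1)])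
      fix x t assume x: "x \<in> S n" "x + t *\<^sub>R v \<in> S n"
      show "t < r / real (Suc n)"
      proof (rule ccontr)
        assume "\<not> t < r / real (Suc n)"
        then have t: "r / real (Suc n) \<le> t" by simp
        moreover have "0 < r / real (Suc n)" using r(1) by (intro divide_pos_pos) auto
        ultimately have "0 < t" by linarith
        \<comment> \<open>Inside the strip \<psi> stays between -2 \<delta> n and 0, so it cannot
          rise by 2 \<delta> n.\<close>
        have "c * t \<le> \<psi> (x + t *\<^sub>R v) - \<psi> x"
        proof (rule directional_growth[of "ball p r" \<psi> g])
          show "(\<psi> has_derivative (\<lambda>w. g y \<bullet> w)) (at y)" "c \<le> g y \<bullet> v" if "y \<in> ball p r" for y
            using that bs svc(4,5) gder by blast+
        qed (use x \<open>0 < t\<close> in \<open>auto simp: S_def\<close>)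
        moreover have "2 * \<delta> n \<le> c * t"
          unfolding \<delta>2 using t svc(2) by (intro mult_left_mono) auto
        moreover have "\<psi> (x + t *\<^sub>R v) < 0"
          using x \<Omega>U[OF inU] by (auto simp: S_def less_imp_le)
        moreover have "- 2 * \<delta> n < \<psi> x" using x by (simp add: S_def)
        ultimately show False by linarith
      qed
    qed (auto simp: S_def)
    then show ?thesis by (simp add: field_simps)
  qed
  show ?thesis
  proof (rule that[OF r(1)])
    fix F F'
    assume tf: "tangential_field \<Omega> F F'" and F0: "\<And>x. x \<in> \<Omega> - ball p r \<Longrightarrow> F x = 0"
    have F: "continuous_on (closure \<Omega>) F" "\<And>x. x \<in> \<Omega> \<Longrightarrow> (F has_derivative F' x) (at x)"
      "\<And>v. continuous_on \<Omega> (\<lambda>x. F' x v)"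
      "\<And>x n. x \<in> frontier \<Omega> \<Longrightarrow> outward_unit_normal \<Omega> x n \<Longrightarrow> F x \<bullet> n = 0"
      "integrable (lebesgue_on \<Omega>) (\<lambda>x. \<Sum>b\<in>Basis. F' x b \<bullet> b)"
      using tf by (auto simp: tangential_field_def)
    define d where "d = (\<lambda>x. \<Sum>b\<in>Basis. F' x b \<bullet> b)"
    have Fcont: "continuous_on \<Omega> F"
      using F(1) closure_subset continuous_on_subset by blast
    have cover: "\<Omega> \<subseteq> ball p s \<union> - cball p r" using r by auto
    have out: "open (\<Omega> \<inter> - cball p r)" using \<Omega> by auto
    have F0out: "F x = 0" if "x \<in> \<Omega> \<inter> - cball p r" for x using F0[of x] that by auto
    have F'0: "F' x = (\<lambda>v. 0)" if "x \<in> \<Omega> \<inter> - cball p r" for x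
    proof -
      have "((\<lambda>x. 0) has_derivative F' x) (at x)"
        by (rule has_derivative_transform_within_open[OF F(2) out that]) (use that F0out in auto)
      then show ?thesis by (rule has_derivative_unique[OF _ has_derivative_const])
    qed
    \<comment> \<open>The contribution grad (w n) . F of the cut-off to the divergence of w n F; the
      task is to show that its integral tends to 0.\<close>
    define e where "e = (\<lambda>n x. a n x * (g x \<bullet> F x))"
    define H' where "H' = (\<lambda>n x v. w n x *\<^sub>R F' x v + (a n x * (g x \<bullet> v)) *\<^sub>R F x)"
    have trH: "(\<Sum>b\<in>Basis. H' n x b \<bullet> b) = w n x * d x + e n x" for n x
      using trace_scaleR_add[of "w n x" "F' x" "a n x *\<^sub>R g x" "F x"]
      by (simp add: H'_def d_def e_def)
    \<comment> \<open>The level -\<delta> n stays away from the boundary, so K n is compact inside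
      \<Omega>, and w n F vanishes on the rest of \<Omega>.\<close>
    define K where "K = (\<lambda>n. {x \<in> cball p r. \<psi> x \<le> - \<delta> n})"
    have K: "compact (K n)" "K n \<subseteq> \<Omega>" for n
    proof -
      have "closed (cball p r \<inter> \<psi> -` {.. - \<delta> n})"
        by (intro continuous_closed_preimage continuous_on_subset[OF \<psi>cont] rU) auto
      then have "compact (cball p r \<inter> (cball p r \<inter> \<psi> -` {.. - \<delta> n}))"
        by (intro compact_Int_closed) auto
      also have "cball p r \<inter> (cball p r \<inter> \<psi> -` {.. - \<delta> n}) = K n" by (auto simp: K_def)
      finally show "compact (K n)" .
      show "K n \<subseteq> \<Omega>"
      proof
        fix x assume "x \<in> K n"
        then show "x \<in> \<Omega>" using \<Omega>U[OF inU, of x] \<delta>[of n] by (auto simp: K_def)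
      qed
    qed
    have Hder: "((\<lambda>x. w n x *\<^sub>R F x) has_derivative H' n x) (at x)" if x: "x \<in> \<Omega>" for n x
    proof (cases "x \<in> ball p s")
      case True
      then have "x \<in> U" using svc by auto
      show ?thesis
        using has_derivative_scaleR[OF wder[OF \<open>x \<in> U\<close>] F(2)[OF x]]
        by (simp add: H'_def)
    next
      case False
      then have x': "x \<in> \<Omega> \<inter> - cball p r" using x r by auto
      have "H' n x = (\<lambda>v. 0)"
        using F'0[OF x'] F0[of x] x' by (auto simp: H'_def)
      then have "((\<lambda>x. 0) has_derivative H' n x) (at x)" by simp
      then show ?thesis
        by (rule has_derivative_transform_within_open[OF _ out x']) (use F0out in auto)
    qed
    have Hcont: "continuous_on \<Omega> (\<lambda>x. H' n x v)" for n v
    proof (rule continuous_on_zero_extend[OF _ _ cover \<Omega>(1)])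
      have sub: "\<Omega> \<inter> ball p s \<subseteq> U" "\<Omega> \<inter> ball p s \<subseteq> \<Omega>" using svc by auto
      show "continuous_on (\<Omega> \<inter> ball p s) (\<lambda>x. H' n x v)"
        unfolding H'_def
        by (intro continuous_intros continuous_on_subset[OF wcont sub(1)] continuous_on_subset[OF acont sub(1)]
            continuous_on_subset[OF gcont sub(1)] continuous_on_subset[OF F(3) sub(2)]
            continuous_on_subset[OF Fcont sub(2)])
      show "H' n x v = 0" if "x \<in> \<Omega> \<inter> - cball p r" for x
        using F'0[OF that] F0[of x] that by (auto simp: H'_def)
    qed auto
    have Hzero: "w n x *\<^sub>R F x = 0" if "x \<in> \<Omega> - K n" for n x
    proof (cases "x \<in> ball p r")
      case True
      then have "- \<delta> n < \<psi> x" using that by (auto simp: K_def)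
      then have "w n x = 0"
        unfolding w_def using \<delta>[of n] by (intro \<eta>(3)) (simp add: field_simps)
      then show ?thesis by simp
    qed (use F0 that in simp)
    have IH: "integral\<^sup>L (lebesgue_on \<Omega>) (\<lambda>x. w n x * d x + e n x) = 0"
      "integrable (lebesgue_on \<Omega>) (\<lambda>x. w n x * d x + e n x)" for n
      using divergence_compact_support[OF \<Omega>(1) Hder Hcont K[of n] Hzero[of _ n]]
      by (simp_all add: trH)
    have econt: "continuous_on \<Omega> (e n)" for n
    proof (rule continuous_on_zero_extend[OF _ _ cover \<Omega>(1)])
      have sub: "\<Omega> \<inter> ball p s \<subseteq> U" "\<Omega> \<inter> ball p s \<subseteq> \<Omega>" using svc by auto
      show "continuous_on (\<Omega> \<inter> ball p s) (e n)"
        unfolding e_def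
        by (intro continuous_intros continuous_on_subset[OF acont sub(1)]
            continuous_on_subset[OF gcont sub(1)] continuous_on_subset[OF Fcont sub(2)])
      show "e n x = 0" if "x \<in> \<Omega> \<inter> - cball p r" for x
        using F0[of x] that by (auto simp: e_def)
    qed auto
    have e0: "e n x = 0" if "x \<in> \<Omega> - S n" for n x
    proof (cases "x \<in> ball p r")
      case True
      then have "\<psi> x \<le> - 2 * \<delta> n" using that by (auto simp: S_def)
      then have "a n x = 0"
        unfolding a_def using \<delta>[of n] by (subst \<eta>(7)) (auto simp: field_simps)
      then show ?thesis by (simp add: e_def)
    qed (use F0 that in \<open>simp add: e_def\<close>)
    have e_bound: "\<bar>e n x\<bar> \<le> indicator (S n) x * (C / \<delta> n * B)"
      if B: "\<And>x. x \<in> S n \<Longrightarrow> \<bar>g x \<bullet> F x\<bar> \<le> B" and x: "x \<in> \<Omega>" for n x B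
    proof (cases "x \<in> S n")
      case True
      have "\<bar>a n x\<bar> \<le> C / \<delta> n"
        using \<delta>[of n] \<eta>(8)[of "- \<psi> x / \<delta> n - 1"] by (simp add: a_def divide_right_mono abs_divide)
      then have "\<bar>a n x\<bar> * \<bar>g x \<bullet> F x\<bar> \<le> C / \<delta> n * B"
        using B[OF True] \<eta>(9) \<delta>[of n] by (intro mult_mono) auto
      then show ?thesis using True by (simp add: e_def abs_mult)
    qed (use e0 x in simp)
    define A where "A = closure \<Omega> \<inter> cball p r"
    have A: "compact A" "A \<subseteq> U"
      unfolding A_def using \<Omega> rU by (auto intro!: compact_Int_closed simp: compact_closure)
    have gF: "continuous_on A (\<lambda>x. g x \<bullet> F x)"
      by (intro continuous_intros continuous_on_subset[OF gcont A(2)] continuous_on_subset[OF F(1)])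
        (auto simp: A_def)
    have SA: "S n \<subseteq> A" for n using closure_subset by (force simp: S_def A_def)
    have "bounded ((\<lambda>x. g x \<bullet> F x) ` A)"
      by (intro compact_imp_bounded compact_continuous_image gF A)
    then obtain B0 where B0: "0 < B0" "\<And>x. x \<in> A \<Longrightarrow> \<bar>g x \<bullet> F x\<bar> \<le> B0"
      by (auto simp: bounded_pos)
    have ind_int: "integrable (lebesgue_on \<Omega>) (\<lambda>x. indicator (S n) x * B)" 
      and ind_val: "integral\<^sup>L (lebesgue_on \<Omega>) (\<lambda>x. indicator (S n) x * B) = measure lebesgue (S n) * B"
      for n and B :: real
    proof -
      have *: "indicator \<Omega> x * (indicator (S n) x * B) = indicator (S n) x * B" for x :: 'a
        by (auto simp: indicator_def S_def)
      have "integrable lebesgue (indicator (S n) :: _ \<Rightarrow> real)"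
        using Smeas[of n] by (simp add: lmeasurable_iff_integrable)
      then show "integrable (lebesgue_on \<Omega>) (\<lambda>x. indicator (S n) x * B)"
        using \<Omega> by (subst integrable_restrict_space) (auto simp: *)
      show "integral\<^sup>L (lebesgue_on \<Omega>) (\<lambda>x. indicator (S n) x * B) = measure lebesgue (S n) * B"
        using \<Omega> by (subst integral_restrict_space) (auto simp: *)
    qed
    have eint: "integrable (lebesgue_on \<Omega>) (e n)" for n
    proof (rule Bochner_Integration.integrable_bound[OF ind_int[of n "C / \<delta> n * B0"]])
      show "e n \<in> borel_measurable (lebesgue_on \<Omega>)"
        using \<Omega> by (intro continuous_imp_measurable_on_sets_lebesgue econt) auto
      show "AE x in lebesgue_on \<Omega>. norm (e n x) \<le> norm (indicator (S n) x * (C / \<delta> n * B0))"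
      proof (intro AE_I2)
        fix x assume "x \<in> space (lebesgue_on \<Omega>)"
        then have "\<bar>e n x\<bar> \<le> indicator (S n) x * (C / \<delta> n * B0)"
          using B0(2) SA by (intro e_bound) auto
        then show "norm (e n x) \<le> norm (indicator (S n) x * (C / \<delta> n * B0))"
          unfolding real_norm_def by (rule order_trans[OF _ abs_ge_self])
      qed
    qed
    have wint: "integrable (lebesgue_on \<Omega>) (\<lambda>x. w n x * d x)" for n
      using Bochner_Integration.integrable_diff[OF IH(2)[of n] eint[of n]] by simp
    have eval: "integral\<^sup>L (lebesgue_on \<Omega>) (\<lambda>x. w n x * d x) = - integral\<^sup>L (lebesgue_on \<Omega>) (e n)" for n
      using IH(1)[of n] wint[of n] eint[of n] by simp
    \<comment> \<open>Integrability of the divergence enters here, as domination; at each point of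
      \<Omega> either d vanishes or w n equals 1 from some n on.\<close>
    have "(\<lambda>n. integral\<^sup>L (lebesgue_on \<Omega>) (\<lambda>x. w n x * d x)) \<longlonglongrightarrow> integral\<^sup>L (lebesgue_on \<Omega>) d"
    proof (rule integral_dominated_convergence[where w = "\<lambda>x. \<bar>d x\<bar>"])
      show "AE x in lebesgue_on \<Omega>. (\<lambda>n. w n x * d x) \<longlonglongrightarrow> d x"
      proof (intro AE_I2)
        fix x assume "x \<in> space (lebesgue_on \<Omega>)"
        then have x: "x \<in> \<Omega>" by simp
        show "(\<lambda>n. w n x * d x) \<longlonglongrightarrow> d x"
        proof (cases "x \<in> cball p r")
          case True
          then have "\<psi> x < 0" using \<Omega>U[OF inU, of x] x by auto
          then have "\<forall>\<^sub>F n in sequentially. \<delta> n < - \<psi> x / 2"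
            using order_tendstoD(2)[OF \<delta>lim] by simp
          then have "\<forall>\<^sub>F n in sequentially. w n x * d x = d x"
          proof eventually_elim
            case (elim n)
            then have "w n x = 1" unfolding w_def
              using \<delta>[of n] by (intro \<eta>(4)) (simp add: field_simps)
            then show ?case by simp
          qed
          then show ?thesis by (rule tendsto_eventually)
        next
          case False
          then have "d x = 0" using F'0[of x] x by (simp add: d_def)
          then show ?thesis by simp
        qed
      qed
      show "AE x in lebesgue_on \<Omega>. norm (w n x * d x) \<le> \<bar>d x\<bar>" for n
        using \<eta>(5,6) by (auto simp: w_def abs_mult intro!: mult_left_le_one_le)
    qed (use F(5) wint borel_measurable_integrable in \<open>auto simp: d_def[symmetric]\<close>)
    moreover have "(\<lambda>n. integral\<^sup>L (lebesgue_on \<Omega>) (e n)) \<longlonglongrightarrow> 0"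
    proof (rule LIMSEQ_I)
      fix \<epsilon> :: real assume "0 < \<epsilon>"
      \<comment> \<open>The estimate will be (V / (n + 1)) (C / \<delta> n) \<epsilon>', and since
        \<delta> n = c r / (2 (n + 1)) the factors n + 1 cancel. This choice makes it \<epsilon> / 2
        times V / (V + 1) for every n; V + 1 keeps the denominator positive.\<close>
      define \<epsilon>' where "\<epsilon>' = \<epsilon> * c * r / (4 * C * (V + 1))"
      have "0 \<le> V" by (simp add: V_def)
      then have \<epsilon>': "0 < \<epsilon>'" using \<open>0 < \<epsilon>\<close> svc r \<eta>(9) by (simp add: \<epsilon>'_def)
      \<comment> \<open>Where the normal component is not small: a compact set that tangency keeps
        off the boundary. There \<psi> has a negative maximum, so thin strips miss it.\<close>
      define Z where "Z = A \<inter> (\<lambda>x. \<bar>g x \<bullet> F x\<bar>) -` {\<epsilon>'..}"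
      have Z: "compact Z"
      proof -
        have "closed Z" unfolding Z_def
          by (intro continuous_closed_preimage continuous_intros gF) (use A compact_imp_closed in auto)
        then have "compact (A \<inter> Z)" using A by (intro compact_Int_closed)
        also have "A \<inter> Z = Z" by (auto simp: Z_def)
        finally show ?thesis .
      qed
      have Zneg: "\<psi> x < 0" if "x \<in> Z" for x
      proof (rule ccontr)
        assume neg: "\<not> \<psi> x < 0"
        have xA: "x \<in> A" using that by (simp add: Z_def)
        then have xU: "x \<in> U" using A by auto
        have "x \<notin> \<Omega>" using \<Omega>U[OF xU] neg by auto
        then have fr: "x \<in> frontier \<Omega>"
          using xA \<Omega> by (simp add: A_def frontier_def interior_open)
        have "x \<in> ball p s" using xA inps by (auto simp: A_def)
        \<comment> \<open>The slope bound c > 0 makes U and \<psi> a local defining function at x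
          too, so the boundary condition at x concerns the direction g x.\<close>
        then have "g x \<noteq> 0" using svc(2,5) by fastforce
        then have "local_defining_function \<Omega> x U \<psi>"
          using ldf xU by (simp add: local_defining_function_def g_def)
        then have "outward_unit_normal \<Omega> x (g x /\<^sub>R norm (g x))"
          unfolding outward_unit_normal_def g_def by blast
        from F(4)[OF fr this] have "g x \<bullet> F x = 0"
          using \<open>g x \<noteq> 0\<close> by (simp add: inner_commute)
        then show False using that \<epsilon>' by (simp add: Z_def)
      qed
      obtain \<delta>0 where \<delta>0: "0 < \<delta>0" "\<And>x. x \<in> Z \<Longrightarrow> \<psi> x \<le> - \<delta>0"
      proof (cases "Z = {}")
        case True
        then show ?thesis using that[of 1] by simp
      next
        case False
        have "continuous_on Z \<psi>"
          by (rule continuous_on_subset[OF \<psi>cont]) (use A in \<open>auto simp: Z_def\<close>)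
        from continuous_attains_sup[OF Z False this] obtain z
          where "z \<in> Z" "\<And>y. y \<in> Z \<Longrightarrow> \<psi> y \<le> \<psi> z" by blast
        then show ?thesis using that[of "- \<psi> z"] Zneg by auto
      qed
      have "\<forall>\<^sub>F n in sequentially. \<delta> n < \<delta>0 / 2"
        using order_tendstoD(2)[OF \<delta>lim, of "\<delta>0 / 2"] \<delta>0(1) by simp
      then have "\<forall>\<^sub>F n in sequentially. norm (integral\<^sup>L (lebesgue_on \<Omega>) (e n) - 0) < \<epsilon>"
      proof eventually_elim
        case (elim n)
        have B: "\<bar>g x \<bullet> F x\<bar> \<le> \<epsilon>'" if "x \<in> S n" for x
        proof (rule ccontr)
          assume "\<not> \<bar>g x \<bullet> F x\<bar> \<le> \<epsilon>'"
          then have "x \<in> Z" using SA that by (auto simp: Z_def)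
          then have "\<psi> x \<le> - \<delta>0" by (rule \<delta>0)
          then show False using that elim by (simp add: S_def)
        qed
        have "norm (integral\<^sup>L (lebesgue_on \<Omega>) (e n)) \<le> integral\<^sup>L (lebesgue_on \<Omega>) (\<lambda>x. indicator (S n) x * (C / \<delta> n * \<epsilon>'))"
        proof (rule order_trans[OF integral_norm_bound Bochner_Integration.integral_mono])
          show "norm (e n x) \<le> indicator (S n) x * (C / \<delta> n * \<epsilon>')" if "x \<in> space (lebesgue_on \<Omega>)" for x
            using e_bound[of n \<epsilon>' x] B that by simp
        qed (auto intro: eint ind_int)
        also have "\<dots> = measure lebesgue (S n) * (C / \<delta> n * \<epsilon>')" by (rule ind_val)
        also have "\<dots> \<le> V / real (Suc n) * (C / \<delta> n * \<epsilon>')"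
          using SV \<epsilon>' \<delta>[of n] \<eta>(9) by (intro mult_right_mono) auto
        also have "\<dots> = \<epsilon> / 2 * (V / (V + 1))"
          using svc r \<eta>(9) \<open>0 \<le> V\<close> by (simp add: \<delta>_def \<epsilon>'_def divide_simps) (simp add: algebra_simps)
        also have "\<dots> \<le> \<epsilon> / 2 * 1"
          using \<open>0 < \<epsilon>\<close> \<open>0 \<le> V\<close> by (intro mult_left_mono) auto
        also have "\<dots> < \<epsilon>" using \<open>0 < \<epsilon>\<close> by simp
        finally show ?case by simp
      qed
      then show "\<exists>no. \<forall>n\<ge>no. norm (integral\<^sup>L (lebesgue_on \<Omega>) (e n) - 0) < \<epsilon>"
        by (simp add: eventually_sequentially)
    qed
    then have "(\<lambda>n. integral\<^sup>L (lebesgue_on \<Omega>) (\<lambda>x. w n x * d x)) \<longlonglongrightarrow> - 0"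
      unfolding eval by (rule tendsto_minus)
    ultimately show "(LINT x|lebesgue_on \<Omega>. (\<Sum>b\<in>Basis. F' x b \<bullet> b)) = 0"
      unfolding d_def using LIMSEQ_unique by fastforce
  qed
qed

section \<open>From small balls to the whole domain\<close>

lemma integrable_continuous_closure:
  fixes f :: "'a::euclidean_space \<Rightarrow> 'b::euclidean_space"
  assumes "open \<Omega>" "bounded \<Omega>" "continuous_on (closure \<Omega>) f"
  shows "integrable (lebesgue_on \<Omega>) f"
proof -
  have "integrable lborel (\<lambda>x. indicator (closure \<Omega>) x *\<^sub>R f x)"
    using assms by (intro borel_integrable_compact) (auto simp: compact_closure)
  then have "integrable lebesgue (\<lambda>x. indicator (closure \<Omega>) x *\<^sub>R f x)"
    by (subst integrable_completion) auto
  then have "integrable lebesgue (\<lambda>x. indicator \<Omega> x *\<^sub>R (indicator (closure \<Omega>) x *\<^sub>R f x))"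
    by (rule integrable_mult_indicator[rotated]) (use assms(1) in auto)
  also have "(\<lambda>x. indicator \<Omega> x *\<^sub>R (indicator (closure \<Omega>) x *\<^sub>R f x)) = (\<lambda>x. indicator \<Omega> x *\<^sub>R f x)"
    using closure_subset[of \<Omega>] by (auto simp: indicator_def fun_eq_iff)
  finally show ?thesis
    using assms(1) by (subst integrable_restrict_space) auto
qed

text \<open>The second factor may be M, \<rho> or a divergence, none of which need be bounded; the
  continuous factor is, by compactness of the closure.\<close>

lemma integrable_continuous_closure_mult:
  fixes f g :: "'a::euclidean_space \<Rightarrow> real"
  assumes "open \<Omega>" "bounded \<Omega>" "continuous_on (closure \<Omega>) f" "integrable (lebesgue_on \<Omega>) g"
  shows "integrable (lebesgue_on \<Omega>) (\<lambda>x. f x * g x)"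
proof -
  have "bounded (f ` closure \<Omega>)"
    using assms by (intro compact_imp_bounded compact_continuous_image) (auto simp: compact_closure)
  then obtain B where B: "\<And>x. x \<in> closure \<Omega> \<Longrightarrow> \<bar>f x\<bar> \<le> B"
    by (auto simp: bounded_pos)
  have meas: "f \<in> borel_measurable (lebesgue_on \<Omega>)"
    using assms closure_subset
    by (intro continuous_imp_measurable_on_sets_lebesgue) (auto intro: continuous_on_subset)
  show ?thesis
  proof (rule Bochner_Integration.integrable_bound[of _ "\<lambda>x. B * g x"])
    show "AE x in lebesgue_on \<Omega>. norm (f x * g x) \<le> norm (B * g x)"
    proof (intro AE_I2)
      fix x assume "x \<in> space (lebesgue_on \<Omega>)"
      then have "x \<in> closure \<Omega>" using closure_subset by auto
      then have "\<bar>f x\<bar> \<le> \<bar>B\<bar>" using B by force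
      then show "norm (f x * g x) \<le> norm (B * g x)"
        by (simp add: abs_mult mult_right_mono)
    qed
  qed (use assms meas in auto)
qed

text \<open>A scalar factor preserves tangency, and both terms of the product rule for the
  divergence stay integrable. This serves the partition of unity and, with s a test function,
  Green's identity.\<close>

lemma tangential_field_scaleR:
  assumes \<Omega>: "open \<Omega>" "bounded \<Omega>" and tf: "tangential_field \<Omega> F F'"
    and s: "continuous_on (closure \<Omega>) s" "\<And>x. x \<in> \<Omega> \<Longrightarrow> (s has_derivative (\<lambda>v. h x \<bullet> v)) (at x)"
      "continuous_on (closure \<Omega>) h"
  shows "tangential_field \<Omega> (\<lambda>x. s x *\<^sub>R F x) (\<lambda>x v. s x *\<^sub>R F' x v + (h x \<bullet> v) *\<^sub>R F x)"
proof -
  have F: "continuous_on (closure \<Omega>) F" "\<And>x. x \<in> \<Omega> \<Longrightarrow> (F has_derivative F' x) (at x)"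
    "\<And>v. continuous_on \<Omega> (\<lambda>x. F' x v)"
    "\<And>x n. x \<in> frontier \<Omega> \<Longrightarrow> outward_unit_normal \<Omega> x n \<Longrightarrow> F x \<bullet> n = 0"
    "integrable (lebesgue_on \<Omega>) (\<lambda>x. \<Sum>b\<in>Basis. F' x b \<bullet> b)"
    using tf by (auto simp: tangential_field_def)
  note cl = continuous_on_subset[OF _ closure_subset]
  have "integrable (lebesgue_on \<Omega>) (\<lambda>x. s x * (\<Sum>b\<in>Basis. F' x b \<bullet> b) + h x \<bullet> F x)"
    by (intro Bochner_Integration.integrable_add integrable_continuous_closure_mult[OF \<Omega> s(1) F(5)]
        integrable_continuous_closure[OF \<Omega> continuous_on_inner[OF s(3) F(1)]])
  then have "integrable (lebesgue_on \<Omega>) (\<lambda>x. \<Sum>b\<in>Basis. (s x *\<^sub>R F' x b + (h x \<bullet> b) *\<^sub>R F x) \<bullet> b)"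
    by (simp add: trace_scaleR_add)
  moreover have "((\<lambda>x. s x *\<^sub>R F x) has_derivative (\<lambda>v. s x *\<^sub>R F' x v + (h x \<bullet> v) *\<^sub>R F x)) (at x)"
    if "x \<in> \<Omega>" for x
    by (rule has_derivative_scaleR[OF s(2) F(2)]) (fact that)+
  moreover have "continuous_on \<Omega> (\<lambda>x. s x *\<^sub>R F' x v + (h x \<bullet> v) *\<^sub>R F x)" for v
    by (intro continuous_intros cl[OF s(1)] cl[OF s(3)] cl[OF F(1)] F(3))
  ultimately show ?thesis
    unfolding tangential_field_def using F s by (auto intro!: continuous_intros)
qed

text \<open>The squared positive part of r^2 - |x - p|^2. That it is positive exactly on the open
  ball is used twice, for a covering and to generate the Borel sets.\<close>

lemma C1_bump:
  fixes p :: "'a::euclidean_space"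
  defines "\<theta> \<equiv> \<lambda>r x. (max 0 (r\<^sup>2 - (x - p) \<bullet> (x - p)))\<^sup>2"
    and "h \<equiv> \<lambda>r x. (- 4 * max 0 (r\<^sup>2 - (x - p) \<bullet> (x - p))) *\<^sub>R (x - p)"
  assumes "0 < r"
  shows "(\<theta> r has_derivative (\<lambda>v. h r x \<bullet> v)) (at x)" "continuous_on A (h r)" "0 \<le> \<theta> r x"
    "0 < \<theta> r x \<longleftrightarrow> x \<in> ball p r" "\<theta> r x \<noteq> 0 \<longleftrightarrow> x \<in> ball p r"
proof -
  have "((\<lambda>x. r\<^sup>2 - (x - p) \<bullet> (x - p)) has_derivative (\<lambda>v. - 2 * ((x - p) \<bullet> v))) (at x)"
    by (auto intro!: derivative_eq_intros simp: inner_commute algebra_simps)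
  from has_derivative_compose[OF this has_field_derivative_max_0_power2[unfolded has_field_derivative_def]]
  show "(\<theta> r has_derivative (\<lambda>v. h r x \<bullet> v)) (at x)"
    by (simp add: \<theta>_def h_def mult.assoc)
  show "continuous_on A (h r)"
    unfolding h_def by (intro continuous_intros)
  show "0 \<le> \<theta> r x" by (simp add: \<theta>_def)
  have "(x - p) \<bullet> (x - p) = (dist p x)\<^sup>2"
    by (metis dist_commute dist_norm power2_norm_eq_inner)
  moreover have "(dist p x)\<^sup>2 < r\<^sup>2 \<longleftrightarrow> dist p x < r"
    using assms by (simp flip: not_le)
  ultimately show "0 < \<theta> r x \<longleftrightarrow> x \<in> ball p r" "\<theta> r x \<noteq> 0 \<longleftrightarrow> x \<in> ball p r"
    by (auto simp: \<theta>_def max_def)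
qed

text \<open>The radius comes before the field: it depends on the geometry at p alone, and the fields
  supported in the ball are built afterwards, with bumps of this radius.\<close>

lemma divergence_near_point:
  fixes \<Omega> :: "'a::euclidean_space set"
  assumes "smooth_bounded_domain \<Omega>" "p \<in> closure \<Omega>"
  shows "\<exists>r>0. \<forall>F F'. tangential_field \<Omega> F F' \<longrightarrow> (\<forall>x\<in>\<Omega> - ball p r. F x = 0) \<longrightarrow>
      (LINT x|lebesgue_on \<Omega>. (\<Sum>b\<in>Basis. F' x b \<bullet> b)) = 0"
proof (cases "p \<in> \<Omega>")
  case True
  have \<Omega>: "open \<Omega>" using assms by (simp add: smooth_bounded_domain_def)
  then obtain r where r: "0 < r" "cball p r \<subseteq> \<Omega>"
    using True open_contains_cball by blast
  show ?thesis
  proof (intro exI[of _ r] conjI allI impI r(1))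
    fix F F'
    assume tf: "tangential_field \<Omega> F F'" and F0: "\<forall>x\<in>\<Omega> - ball p r. F x = 0"
    show "(LINT x|lebesgue_on \<Omega>. (\<Sum>b\<in>Basis. F' x b \<bullet> b)) = 0"
    proof (rule divergence_compact_support(1)[OF \<Omega> _ _ compact_cball r(2)])
      show "(F has_derivative F' x) (at x)" if "x \<in> \<Omega>" for x
        using tf that by (simp add: tangential_field_def)
      show "continuous_on \<Omega> (\<lambda>x. F' x v)" for v
        using tf by (simp add: tangential_field_def)
      show "F x = 0" if "x \<in> \<Omega> - cball p r" for x
        using F0 that by auto
    qed
  qed
next
  case False
  have \<Omega>: "open \<Omega>" "bounded \<Omega>" using assms by (simp_all add: smooth_bounded_domain_def)
  have "p \<in> frontier \<Omega>"
    using False assms \<Omega> by (simp add: frontier_def interior_open)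
  then obtain U \<psi> where ldf: "local_defining_function \<Omega> p U \<psi>"
    using assms unfolding smooth_bounded_domain_def by blast
  show ?thesis
    by (rule divergence_near_boundary[OF \<Omega> ldf]) blast
qed

text \<open>Bumps \<open>\<theta> p\<close> around finitely many points have a positive sum \<open>S\<close> on the closure; the local
  result applies to each \<open>\<theta> p / S\<close> times the field.\<close>

theorem divergence_theorem_tangential:
  fixes \<Omega> :: "'a::euclidean_space set"
  assumes dom: "smooth_bounded_domain \<Omega>" and tf: "tangential_field \<Omega> F F'"
  shows "(LINT x|lebesgue_on \<Omega>. (\<Sum>b\<in>Basis. F' x b \<bullet> b)) = 0"
proof -
  have \<Omega>: "open \<Omega>" "bounded \<Omega>" using dom by (simp_all add: smooth_bounded_domain_def)
  define Q where "Q = (\<lambda>p r. 0 < r \<and> (\<forall>F F'. tangential_field \<Omega> F F' \<longrightarrow>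
      (\<forall>x\<in>\<Omega> - ball p r. F x = 0) \<longrightarrow> (LINT x|lebesgue_on \<Omega>. (\<Sum>b\<in>Basis. F' x b \<bullet> b)) = 0))"
  have "\<forall>p\<in>closure \<Omega>. \<exists>r. Q p r"
    using divergence_near_point[OF dom] by (simp add: Q_def)
  then obtain r where Q: "\<forall>p\<in>closure \<Omega>. Q p (r p)"
    by (rule bchoice[THEN exE])
  then have r: "0 < r p" if "p \<in> closure \<Omega>" for p
    using that by (simp add: Q_def)
  have loc: "(LINT x|lebesgue_on \<Omega>. (\<Sum>b\<in>Basis. F' x b \<bullet> b)) = 0"
    if "p \<in> closure \<Omega>" "tangential_field \<Omega> F F'" "\<forall>x\<in>\<Omega> - ball p (r p). F x = 0" for p F F'
    using Q that unfolding Q_def by blast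
  have "compact (closure \<Omega>)" using \<Omega> by (simp add: compact_closure)
  then obtain T where T: "T \<subseteq> closure \<Omega>" "finite T" "closure \<Omega> \<subseteq> (\<Union>p\<in>T. ball p (r p))"
    by (rule compactE_image[of _ "closure \<Omega>" "\<lambda>p. ball p (r p)"]) (use r in auto)
  define \<theta> where "\<theta> = (\<lambda>p x. (max 0 ((r p)\<^sup>2 - (x - p) \<bullet> (x - p)))\<^sup>2)"
  define h where "h = (\<lambda>p x. (- 4 * max 0 ((r p)\<^sup>2 - (x - p) \<bullet> (x - p))) *\<^sub>R (x - p))"
  have rT: "0 < r p" if "p \<in> T" for p using r T that by auto
  have \<theta>: "(\<theta> p has_derivative (\<lambda>v. h p x \<bullet> v)) (at x)" "continuous_on A (h p)" "0 \<le> \<theta> p x"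
    "0 < \<theta> p x \<longleftrightarrow> x \<in> ball p (r p)" "\<theta> p x \<noteq> 0 \<longleftrightarrow> x \<in> ball p (r p)"
    if "p \<in> T" for p x A
    unfolding \<theta>_def h_def by (rule C1_bump[OF rT[OF that]])+
  have \<theta>cont: "continuous_on A (\<theta> p)" for A p
    unfolding \<theta>_def by (intro continuous_intros)
  define S where "S = (\<lambda>x. \<Sum>p\<in>T. \<theta> p x)"
  define H where "H = (\<lambda>x. \<Sum>p\<in>T. h p x)"
  have Spos: "0 < S x" if "x \<in> closure \<Omega>" for x
  proof -
    have "x \<in> (\<Union>p\<in>T. ball p (r p))" using T(3) that by (rule subsetD)
    then obtain p where p: "p \<in> T" "x \<in> ball p (r p)" by blast
    show ?thesis unfolding S_def
      by (rule sum_pos2[OF T(2) p(1)]) (use \<theta>(4)[OF p(1)] p(2) \<theta>(3) in simp_all)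
  qed
  have Sder: "(S has_derivative (\<lambda>v. H x \<bullet> v)) (at x)" for x
    unfolding S_def H_def inner_sum_left by (intro has_derivative_sum \<theta>(1))
  have Scont: "continuous_on A S" for A
    unfolding S_def by (intro continuous_intros \<theta>cont)
  have Hcont: "continuous_on A H" for A
    unfolding H_def by (intro continuous_intros \<theta>(2))
  define k where "k = (\<lambda>x. (- 1 / (S x)\<^sup>2) *\<^sub>R H x)"
  \<comment> \<open>Dividing by S first and multiplying by a bump afterwards makes each of the two
    steps an instance of \<open>tangential_field_scaleR\<close>.\<close>
  define F0 where "F0 = (\<lambda>x. (1 / S x) *\<^sub>R F x)"
  define F0' where "F0' = (\<lambda>x v. (1 / S x) *\<^sub>R F' x v + (k x \<bullet> v) *\<^sub>R F x)"
  have tf0: "tangential_field \<Omega> F0 F0'"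
    unfolding F0_def F0'_def
  proof (rule tangential_field_scaleR[OF \<Omega> tf])
    show "continuous_on (closure \<Omega>) (\<lambda>x. 1 / S x)" "continuous_on (closure \<Omega>) k"
      unfolding k_def using Spos[THEN less_imp_neq]
      by (auto intro!: continuous_on_scaleR continuous_on_divide continuous_on_power
          continuous_on_minus continuous_on_const Scont Hcont)
    show "((\<lambda>x. 1 / S x) has_derivative (\<lambda>v. k x \<bullet> v)) (at x)" if "x \<in> \<Omega>" for x
    proof -
      have "S x \<noteq> 0" using Spos[of x] that closure_subset by force
      then show ?thesis unfolding k_def
        by (auto intro!: derivative_eq_intros Sder simp: power2_eq_square divide_simps)
    qed
  qed
  define F1' where "F1' = (\<lambda>p x v. \<theta> p x *\<^sub>R F0' x v + (h p x \<bullet> v) *\<^sub>R F0 x)"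
  have tf1: "tangential_field \<Omega> (\<lambda>x. \<theta> p x *\<^sub>R F0 x) (F1' p)" if "p \<in> T" for p
    unfolding F1'_def by (rule tangential_field_scaleR[OF \<Omega> tf0 \<theta>cont \<theta>(1,2)[OF that]])
  have int1: "(LINT x|lebesgue_on \<Omega>. (\<Sum>b\<in>Basis. F1' p x b \<bullet> b)) = 0" if "p \<in> T" for p
    by (rule loc[OF _ tf1[OF that]]) (use T(1) that \<theta>(5)[OF that] in blast, use \<theta>(5)[OF that] in force)
  \<comment> \<open>The bumps sum to S, which restores F: their gradient term H . F / S cancels S k
    . F, as k = -H / S^2.\<close>
  have sum_eq: "(\<Sum>p\<in>T. \<Sum>b\<in>Basis. F1' p x b \<bullet> b) = (\<Sum>b\<in>Basis. F' x b \<bullet> b)" if "x \<in> \<Omega>" for x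
  proof -
    have nz: "S x \<noteq> 0" using Spos[of x] that closure_subset by force
    have t: "(\<Sum>b\<in>Basis. F0' x b \<bullet> b) = (1 / S x) * (\<Sum>b\<in>Basis. F' x b \<bullet> b) + k x \<bullet> F x"
      unfolding F0'_def by (rule trace_scaleR_add)
    have "(\<Sum>p\<in>T. \<Sum>b\<in>Basis. F1' p x b \<bullet> b) = S x * (\<Sum>b\<in>Basis. F0' x b \<bullet> b) + H x \<bullet> F0 x"
      by (simp add: F1'_def trace_scaleR_add sum.distrib S_def H_def
          sum_distrib_right inner_sum_left)
    also have "\<dots> = (\<Sum>b\<in>Basis. F' x b \<bullet> b)"
      unfolding t using nz by (simp add: F0_def k_def field_simps power2_eq_square)
    finally show ?thesis .
  qed
  have "(LINT x|lebesgue_on \<Omega>. (\<Sum>b\<in>Basis. F' x b \<bullet> b))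
      = (LINT x|lebesgue_on \<Omega>. (\<Sum>p\<in>T. \<Sum>b\<in>Basis. F1' p x b \<bullet> b))"
    by (rule Bochner_Integration.integral_cong) (auto simp: sum_eq)
  also have "\<dots> = (\<Sum>p\<in>T. LINT x|lebesgue_on \<Omega>. (\<Sum>b\<in>Basis. F1' p x b \<bullet> b))"
    by (rule Bochner_Integration.integral_sum) (use tf1 in \<open>auto simp: tangential_field_def\<close>)
  also have "\<dots> = 0" using int1 by simp
  finally show ?thesis .
qed

section \<open>Compactly supported test functions\<close>

text \<open>C^1 with the gradient h carried along, rather than smooth: the class contains the
  explicit bumps and is closed under products and under passing from a nonnegative \<phi> to n
  \<phi> / (1 + n \<phi>).\<close>

definition C1_test :: "'a::euclidean_space set \<Rightarrow> ('a \<Rightarrow> real) \<Rightarrow> ('a \<Rightarrow> 'a) \<Rightarrow> bool" where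
  "C1_test \<Omega> \<phi> h \<longleftrightarrow>
     (\<forall>x. (\<phi> has_derivative (\<lambda>v. h x \<bullet> v)) (at x)) \<and> continuous_on UNIV h \<and>
     (\<exists>K. compact K \<and> K \<subseteq> \<Omega> \<and> (\<forall>x. x \<notin> K \<longrightarrow> \<phi> x = 0))"

lemma C1_test_continuous:
  assumes "C1_test \<Omega> \<phi> h" shows "continuous_on UNIV \<phi>"
proof (rule continuous_at_imp_continuous_on, intro ballI)
  show "isCont \<phi> x" for x
    using assms by (auto simp: C1_test_def intro: has_derivative_continuous)
qed

lemma C1_test_mult:
  assumes "C1_test \<Omega> \<phi> h" "C1_test \<Omega> \<psi> k"
  shows "C1_test \<Omega> (\<lambda>x. \<phi> x * \<psi> x) (\<lambda>x. \<phi> x *\<^sub>R k x + \<psi> x *\<^sub>R h x)"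
proof -
  note c = C1_test_continuous[OF assms(1)] C1_test_continuous[OF assms(2)]
  have "((\<lambda>x. \<phi> x * \<psi> x) has_derivative (\<lambda>v. (\<phi> x *\<^sub>R k x + \<psi> x *\<^sub>R h x) \<bullet> v)) (at x)" for x
    using assms unfolding C1_test_def
    by (auto intro!: derivative_eq_intros simp: inner_add_left algebra_simps)
  moreover have "continuous_on UNIV (\<lambda>x. \<phi> x *\<^sub>R k x + \<psi> x *\<^sub>R h x)"
    using assms unfolding C1_test_def by (intro continuous_intros c) auto
  moreover obtain K where "compact K" "K \<subseteq> \<Omega>" "\<forall>x. x \<notin> K \<longrightarrow> \<phi> x = 0"
    using assms(1) unfolding C1_test_def by blast
  ultimately show ?thesis unfolding C1_test_def by auto
qed

text \<open>The functions \<open>n \<phi> / (1 + n \<phi>)\<close> increase to the indicator of \<open>{\<phi> > 0}\<close>, and the sets of this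
  form are closed under intersection and generate the Borel sets.\<close>

lemma AE_zero_if_C1_test_integrals_zero:
  fixes \<Omega> :: "'a::euclidean_space set" and f :: "'a \<Rightarrow> real"
  assumes \<Omega>: "open \<Omega>" and f: "integrable (lebesgue_on \<Omega>) f"
    and f0: "integral\<^sup>L (lebesgue_on \<Omega>) f = 0"
    and test: "\<And>\<phi> h. C1_test \<Omega> \<phi> h \<Longrightarrow> integral\<^sup>L (lebesgue_on \<Omega>) (\<lambda>x. f x * \<phi> x) = 0"
  shows "AE x in lebesgue_on \<Omega>. f x = 0"
proof -
  let ?N = "lebesgue_on \<Omega>"
  define P where "P = (\<lambda>A. A \<in> sets ?N \<and> set_lebesgue_integral ?N A f = 0)"
  define G where "G = {{x. 0 < \<phi> x} |\<phi> h. C1_test \<Omega> \<phi> h \<and> (\<forall>x. 0 \<le> \<phi> x)}"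
  have sub: "V \<subseteq> \<Omega>" if "V \<in> G" for V
    using that by (force simp: G_def C1_test_def)
  have PG: "P V" if VG: "V \<in> G" for V
  proof -
    obtain \<phi> h where \<phi>: "C1_test \<Omega> \<phi> h" "\<And>x. 0 \<le> \<phi> x" and V: "V = {x. 0 < \<phi> x}"
      using VG by (auto simp: G_def)
    have cont: "continuous_on UNIV \<phi>" by (rule C1_test_continuous[OF \<phi>(1)])
    then have [measurable]: "\<phi> \<in> borel_measurable ?N"
      using \<Omega> by (intro continuous_imp_measurable_on_sets_lebesgue) (auto intro: continuous_on_subset)
    have [measurable]: "f \<in> borel_measurable ?N" using f by auto
    have "open V" unfolding V
      using cont by (intro open_Collect_less continuous_on_const)
    then have V_sets: "V \<in> sets ?N"
      using sub[OF VG] \<Omega> by (subst sets_restrict_space_iff) auto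
    define \<tau> where "\<tau> = (\<lambda>n x. real n * \<phi> x / (1 + real n * \<phi> x))"
    have pos: "1 + real n * \<phi> x > 0" for n x using \<phi>(2)[of x] by (simp add: add_pos_nonneg)
    have "C1_test \<Omega> (\<tau> n) (\<lambda>x. (real n / (1 + real n * \<phi> x)\<^sup>2) *\<^sub>R h x)" for n
      unfolding C1_test_def
    proof (intro conjI allI)
      have d: "(\<phi> has_derivative (\<lambda>v. h x \<bullet> v)) (at x)" for x using \<phi>(1) by (simp add: C1_test_def)
      show "(\<tau> n has_derivative (\<lambda>v. ((real n / (1 + real n * \<phi> x)\<^sup>2) *\<^sub>R h x) \<bullet> v)) (at x)" for x
        unfolding \<tau>_def using pos[of n x]
        by (auto intro!: derivative_eq_intros d simp: power2_eq_square divide_simps)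
          (auto simp: algebra_simps)
      show "continuous_on UNIV (\<lambda>x. (real n / (1 + real n * \<phi> x)\<^sup>2) *\<^sub>R h x)"
      proof (intro continuous_on_scaleR continuous_on_divide continuous_on_power continuous_on_add
          continuous_on_mult continuous_on_const cont ballI)
        show "(1 + real n * \<phi> x)\<^sup>2 \<noteq> 0" for x using pos[of n x] by simp
        show "continuous_on UNIV h" using \<phi>(1) by (simp add: C1_test_def)
      qed
      show "\<exists>K. compact K \<and> K \<subseteq> \<Omega> \<and> (\<forall>x. x \<notin> K \<longrightarrow> \<tau> n x = 0)"
        using \<phi>(1) by (auto simp: C1_test_def \<tau>_def)
    qed
    then have zero: "integral\<^sup>L ?N (\<lambda>x. f x * \<tau> n x) = 0" for n by (rule test)
    have "(\<lambda>n. integral\<^sup>L ?N (\<lambda>x. f x * \<tau> n x)) \<longlonglongrightarrow> integral\<^sup>L ?N (\<lambda>x. indicator V x *\<^sub>R f x)"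
    proof (rule integral_dominated_convergence[where w = "\<lambda>x. \<bar>f x\<bar>"])
      show "(\<lambda>x. f x * \<tau> n x) \<in> borel_measurable ?N" for n
        unfolding \<tau>_def by measurable
      show "(\<lambda>x. indicator V x *\<^sub>R f x) \<in> borel_measurable ?N"
        using V_sets by measurable
      show "AE x in ?N. (\<lambda>n. f x * \<tau> n x) \<longlonglongrightarrow> indicator V x *\<^sub>R f x"
      proof (intro AE_I2)
        fix x
        have "(\<lambda>n. \<tau> n x) \<longlonglongrightarrow> indicator V x"
        proof (cases "x \<in> V")
          case True
          then have "0 < \<phi> x" by (simp add: V)
          then have "(\<lambda>n. real n * \<phi> x / (1 + real n * \<phi> x)) \<longlonglongrightarrow> 1"
            by real_asymp
          then show ?thesis using True by (simp add: \<tau>_def)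
        next
          case False
          then have "\<phi> x = 0" using \<phi>(2)[of x] by (simp add: V)
          then show ?thesis using False by (simp add: \<tau>_def)
        qed
        then show "(\<lambda>n. f x * \<tau> n x) \<longlonglongrightarrow> indicator V x *\<^sub>R f x"
          by (auto intro!: tendsto_eq_intros)
      qed
      show "AE x in ?N. norm (f x * \<tau> n x) \<le> \<bar>f x\<bar>" for n
      proof (intro AE_I2)
        fix x
        have "0 \<le> \<tau> n x" "\<tau> n x \<le> 1" using pos[of n x] \<phi>(2)[of x] by (auto simp: \<tau>_def)
        then show "norm (f x * \<tau> n x) \<le> \<bar>f x\<bar>" by (simp add: abs_mult mult_left_le)
      qed
    qed (use f in auto)
    then have "integral\<^sup>L ?N (\<lambda>x. indicator V x *\<^sub>R f x) = 0"
      unfolding zero by (simp add: LIMSEQ_const_iff)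
    then show ?thesis using V_sets by (simp add: P_def set_lebesgue_integral_def)
  qed
  have Gstable: "Int_stable G"
  proof (rule Int_stableI)
    fix a b assume "a \<in> G" "b \<in> G"
    then obtain \<phi> h \<psi> k where 1: "C1_test \<Omega> \<phi> h" "\<And>x. 0 \<le> \<phi> x" "a = {x. 0 < \<phi> x}"
      and 2: "C1_test \<Omega> \<psi> k" "\<And>x. 0 \<le> \<psi> x" "b = {x. 0 < \<psi> x}"
      by (auto simp: G_def)
    have "a \<inter> b = {x. 0 < \<phi> x * \<psi> x}"
      using 1(2,3) 2(2,3) by (auto simp: zero_less_mult_iff) (meson not_less)+
    then show "a \<inter> b \<in> G"
      unfolding G_def using C1_test_mult[OF 1(1) 2(1)] 1(2) 2(2) by (auto intro!: exI)
  qed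
  \<comment> \<open>Dynkin's induction over the intersection-stable generator; complements are
    covered because the total integral is zero by \<open>f0\<close>.\<close>
  have Psig: "P A" if "A \<in> sigma_sets \<Omega> G" for A
  proof (rule sigma_sets_induct_disjoint[OF Gstable _ that, where P = P])
    show "G \<subseteq> Pow \<Omega>" using sub by auto
    show "P A" if "A \<in> G" for A using that by (rule PG)
    show "P {}" by (simp add: P_def set_lebesgue_integral_def)
  next
    fix A assume "P A"
    then have A: "A \<in> sets ?N" "A \<subseteq> \<Omega>" "integral\<^sup>L ?N (\<lambda>x. indicator A x *\<^sub>R f x) = 0"
      using sets.sets_into_space[of A ?N] by (auto simp: P_def set_lebesgue_integral_def)
    have "space ?N - A \<in> sets ?N" using A by blast
    then have s: "\<Omega> - A \<in> sets ?N" by simp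
    have "integral\<^sup>L ?N (\<lambda>x. indicator (\<Omega> - A) x *\<^sub>R f x) = integral\<^sup>L ?N (\<lambda>x. f x - indicator A x *\<^sub>R f x)"
      by (rule Bochner_Integration.integral_cong) (auto simp: indicator_def)
    also have "\<dots> = 0"
      using f f0 A integrable_mult_indicator[OF A(1) f] by simp
    finally show "P (\<Omega> - A)" using s by (simp add: P_def set_lebesgue_integral_def)
  next
    fix A :: "nat \<Rightarrow> 'a set" assume disj: "disjoint_family A" and PA: "\<And>i. P (A i)"
    have A: "A i \<in> sets ?N" "set_lebesgue_integral ?N (A i) f = 0" for i
      using PA[of i] by (auto simp: P_def)
    have U: "(\<Union>i. A i) \<in> sets ?N" using A by blast
    have "set_lebesgue_integral ?N (\<Union>i. A i) f = (\<Sum>i. set_lebesgue_integral ?N (A i) f)"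
    proof (rule lebesgue_integral_countable_add[OF A(1)])
      show "set_integrable ?N (\<Union>i. A i) f"
        unfolding set_integrable_def by (rule integrable_mult_indicator[OF U f])
    qed (use disj in \<open>auto simp: disjoint_family_on_def\<close>)
    then show "P (\<Union>i. A i)" using U A by (simp add: P_def)
  qed
  have ball: "ball p r \<in> G" if "0 < r" "cball p r \<subseteq> \<Omega>" for p r
  proof -
    define \<theta> where "\<theta> = (\<lambda>x. (max 0 (r\<^sup>2 - (x - p) \<bullet> (x - p)))\<^sup>2)"
    define h where "h = (\<lambda>x. (- 4 * max 0 (r\<^sup>2 - (x - p) \<bullet> (x - p))) *\<^sub>R (x - p))"
    have b: "(\<theta> has_derivative (\<lambda>v. h x \<bullet> v)) (at x)" "continuous_on UNIV h" "0 \<le> \<theta> x"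
      "0 < \<theta> x \<longleftrightarrow> x \<in> ball p r" "\<theta> x \<noteq> 0 \<longleftrightarrow> x \<in> ball p r" for x
      unfolding \<theta>_def h_def by (rule C1_bump[OF that(1)])+
    have "\<theta> x = 0" if "x \<notin> cball p r" for x
      using b(5)[of x] that by auto
    then have "C1_test \<Omega> \<theta> h"
      unfolding C1_test_def
      by (intro conjI allI exI[of _ "cball p r"] b compact_cball that(2)) simp
    moreover have "ball p r = {x. 0 < \<theta> x}"
      using b(4) by blast
    ultimately show ?thesis unfolding G_def using b(3) by blast
  qed
  \<comment> \<open>W is a union of possibly uncountably many balls; Lindelof's theorem leaves
    countably many, as a sigma-algebra requires.\<close>
  have op: "W \<in> sigma_sets \<Omega> G" if W: "open W" "W \<subseteq> \<Omega>" for W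
  proof -
    define B where "B = {ball p r |p r. 0 < r \<and> cball p r \<subseteq> W}"
    have "\<And>S. S \<in> B \<Longrightarrow> open S" by (auto simp: B_def)
    then obtain B' where B': "B' \<subseteq> B" "countable B'" "\<Union>B' = \<Union>B"
      by (rule Lindelof)
    have "W \<subseteq> \<Union>B"
    proof
      fix x assume "x \<in> W"
      then obtain r where "0 < r" "cball x r \<subseteq> W" using W open_contains_cball by blast
      then show "x \<in> \<Union>B" unfolding B_def by (auto intro!: exI[of _ "ball x r"])
    qed
    moreover have "\<Union>B \<subseteq> W" using ball_subset_cball by (force simp: B_def)
    ultimately have "W = \<Union>B'" using B' by auto
    moreover have "B' \<subseteq> sigma_sets \<Omega> G"
      using B'(1) ball W(2) by (force simp: B_def)
    ultimately show ?thesis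
      using B'(2) sigma_algebra.countable_Union[OF sigma_algebra_sigma_sets, of G \<Omega> B'] sub by auto
  qed
  have bor: "\<Omega> \<inter> A \<in> sigma_sets \<Omega> G" if "A \<in> sets borel" for A
  proof -
    have "A \<in> sigma_sets UNIV {S. open S}" using that by (simp add: borel_def)
    then show ?thesis
    proof induction
      case (Basic A) then show ?case using \<Omega> by (intro op) auto
    next
      case Empty then show ?case by (simp add: sigma_sets.Empty)
    next
      case (Compl A)
      have "\<Omega> \<inter> (UNIV - A) = \<Omega> - (\<Omega> \<inter> A)" by auto
      then show ?case using sigma_sets.Compl[OF Compl.IH] by simp
    next
      case (Union A)
      have "\<Omega> \<inter> (\<Union>i. A i) = (\<Union>i. \<Omega> \<inter> A i)" by auto
      then show ?case using sigma_sets.Union[of "\<lambda>i. \<Omega> \<inter> A i", OF Union.IH] by simp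
    qed
  qed
  show ?thesis
  proof (rule density_unique_real[OF f integrable_zero])
    fix A assume A: "A \<in> sets ?N"
    then have A': "A \<in> sets lebesgue" "A \<subseteq> \<Omega>"
      using \<Omega> by (auto simp: sets_restrict_space_iff)
    \<comment> \<open>A Lebesgue set differs from a Borel set by a null set, which the integral does
      not see.\<close>
    obtain S M N' where S: "A = S \<union> M" "M \<subseteq> N'" "N' \<in> null_sets lborel" "S \<in> sets lborel"
      using A'(1) by (rule sets_completionE)
    have "N' \<in> null_sets lebesgue" using S(3) by (rule null_sets_completionI)
    then have "AE x in lebesgue. x \<notin> N'" by (rule AE_not_in)
    then have AEN: "AE x in ?N. x \<notin> N'"
      using \<Omega> by (subst AE_restrict_space_iff) auto
    have PS: "P (\<Omega> \<inter> S)" using S(4) by (intro Psig bor) simp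
    have [measurable]: "f \<in> borel_measurable ?N" "A \<in> sets ?N" "\<Omega> \<inter> S \<in> sets ?N"
      using f A PS by (auto simp: P_def)
    have "set_lebesgue_integral ?N A f = set_lebesgue_integral ?N (\<Omega> \<inter> S) f"
      unfolding set_lebesgue_integral_def
    proof (rule integral_cong_AE)
      show "AE x in ?N. indicat_real A x *\<^sub>R f x = indicat_real (\<Omega> \<inter> S) x *\<^sub>R f x"
        using AEN AE_space by eventually_elim (use S A' in \<open>auto simp: indicator_def\<close>)
    qed measurable
    then show "set_lebesgue_integral ?N A f = set_lebesgue_integral ?N A (\<lambda>x. 0)"
      using PS by (simp add: P_def set_lebesgue_integral_def)
  qed
qed

section \<open>Admissible test functions of the variational problem\<close>

lemma C1_test_integral_gradient:
  assumes "open \<Omega>" "C1_test \<Omega> \<phi> h"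
  shows "integrable (lebesgue_on \<Omega>) h" "integral\<^sup>L (lebesgue_on \<Omega>) h = 0"
proof -
  obtain K where K: "compact K" "K \<subseteq> \<Omega>" "\<And>x. x \<notin> K \<Longrightarrow> \<phi> x = 0"
    using assms(2) by (auto simp: C1_test_def)
  have der: "(\<phi> has_derivative (\<lambda>v. h x \<bullet> v)) (at x)" and cont: "continuous_on UNIV h" for x
    using assms(2) by (auto simp: C1_test_def)
  have 0: "h x = 0" if "x \<notin> \<Omega>" for x
    by (rule has_derivative_zero_outside[of "- K" x \<phi>, OF _ _ _ der])
      (use that K in \<open>auto simp: compact_imp_closed\<close>)
  have meas: "h \<in> borel_measurable borel"
    by (rule borel_measurable_continuous_onI[OF cont])
  show "integrable (lebesgue_on \<Omega>) h" "integral\<^sup>L (lebesgue_on \<Omega>) h = 0"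
    using integral_gradient_zero[OF der cont K(1,3)] integral_lebesgue_on_eq_lborel[OF assms(1) meas 0]
    by auto
qed

lemma test_function_imp_C1_test:
  assumes "test_function \<Omega> \<phi>"
  shows "C1_test \<Omega> \<phi> (grad \<phi>)"
proof -
  have "\<phi> x = 0" if "x \<notin> closure {x. \<phi> x \<noteq> 0}" for x
    using that closure_subset[of "{x. \<phi> x \<noteq> 0}"] by auto
  then show ?thesis
    using assms smooth_on_imp_grad[of UNIV \<phi>] unfolding C1_test_def test_function_def by blast
qed

text \<open>The constant is square integrable because \<Omega> is bounded, and its weak gradient is
  0 because gradients of test functions have integral zero. Testing with it uses the Neumann
  condition: nothing leaks through the boundary.\<close>

lemma energy_function_one:
  assumes "open \<Omega>" "bounded \<Omega>" "integrable (lebesgue_on \<Omega>) \<rho>" "integrable (lebesgue_on \<Omega>) M"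
  shows "energy_function \<Omega> M \<rho> (\<lambda>x. 1) (\<lambda>x. 0)"
  unfolding energy_function_def H1_function_def
  using assms integrable_continuous_closure[OF assms(1,2), of "\<lambda>x. 1::real"]
    C1_test_integral_gradient(2)[OF assms(1) test_function_imp_C1_test]
  by auto

text \<open>The weak gradient is the classical one, since the gradient of the product of \<phi> with
  a smooth test function has integral zero.\<close>

lemma energy_function_C1_test:
  assumes \<Omega>: "open \<Omega>" "bounded \<Omega>" and int: "integrable (lebesgue_on \<Omega>) \<rho>" "integrable (lebesgue_on \<Omega>) M"
    and \<phi>: "C1_test \<Omega> \<phi> h"
  shows "energy_function \<Omega> M \<rho> \<phi> h"
proof -
  have c: "continuous_on A \<phi>" "continuous_on A h" for A
    using C1_test_continuous[OF \<phi>] \<phi> by (auto simp: C1_test_def intro: continuous_on_subset)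
  have meas: "\<phi> \<in> borel_measurable (lebesgue_on \<Omega>)" "h \<in> borel_measurable (lebesgue_on \<Omega>)"
    using \<Omega> by (auto intro!: continuous_imp_measurable_on_sets_lebesgue c)
  have "integrable (lebesgue_on \<Omega>) (\<lambda>x. (\<phi> x)\<^sup>2)" "integrable (lebesgue_on \<Omega>) (\<lambda>x. (norm (h x))\<^sup>2)"
    by (intro integrable_continuous_closure[OF \<Omega>] continuous_intros c)+
  moreover have "integrable (lebesgue_on \<Omega>) (\<lambda>x. (\<phi> x)\<^sup>2 * \<rho> x)" "integrable (lebesgue_on \<Omega>) (\<lambda>x. \<phi> x * M x)"
    by (intro integrable_continuous_closure_mult[OF \<Omega>] continuous_intros c int)+
  moreover have "(LINT x|lebesgue_on \<Omega>. \<phi> x *\<^sub>R grad \<psi> x) = - (LINT x|lebesgue_on \<Omega>. \<psi> x *\<^sub>R h x)"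
    if "test_function \<Omega> \<psi>" for \<psi>
  proof -
    note \<psi> = test_function_imp_C1_test[OF that]
    have d: "continuous_on A \<psi>" "continuous_on A (grad \<psi>)" for A
      using C1_test_continuous[OF \<psi>] \<psi> by (auto simp: C1_test_def intro: continuous_on_subset)
    have "integrable (lebesgue_on \<Omega>) (\<lambda>x. \<phi> x *\<^sub>R grad \<psi> x)" "integrable (lebesgue_on \<Omega>) (\<lambda>x. \<psi> x *\<^sub>R h x)"
      by (intro integrable_continuous_closure[OF \<Omega>] continuous_intros c d)+
    then show ?thesis
      using C1_test_integral_gradient(2)[OF \<Omega>(1) C1_test_mult[OF \<phi> \<psi>]]
      by (simp add: eq_neg_iff_add_eq_0)
  qed
  ultimately show ?thesis
    unfolding energy_function_def H1_function_def using meas by (simp add: mult.commute)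
qed

section \<open>The energy balance\<close>

text \<open>g stands for the weak gradient or for the continuous extension of the classical one. The
  three equations are the weak formulation tested with u, with 1 and with \<open>C1_test\<close>
  functions.\<close>

definition energy_balance ::
    "'a::euclidean_space set \<Rightarrow> real \<Rightarrow> ('a \<Rightarrow> real) \<Rightarrow> ('a \<Rightarrow> real) \<Rightarrow> ('a \<Rightarrow> real) \<Rightarrow> ('a \<Rightarrow> 'a) \<Rightarrow> bool" where
  "energy_balance \<Omega> \<kappa> M \<rho> u g \<longleftrightarrow>
     u \<in> borel_measurable (lebesgue_on \<Omega>) \<and> integrable (lebesgue_on \<Omega>) (\<lambda>x. (norm (g x))\<^sup>2) \<and>
     integrable (lebesgue_on \<Omega>) (\<lambda>x. \<rho> x * (u x)\<^sup>2) \<and> integrable (lebesgue_on \<Omega>) (\<lambda>x. M x * u x) \<and>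
     (LINT x|lebesgue_on \<Omega>. (norm (g x))\<^sup>2) + \<kappa> * (LINT x|lebesgue_on \<Omega>. \<rho> x * (u x)\<^sup>2)
       = (LINT x|lebesgue_on \<Omega>. M x * u x) \<and>
     \<kappa> * (LINT x|lebesgue_on \<Omega>. \<rho> x * u x) = integral\<^sup>L (lebesgue_on \<Omega>) M \<and>
     (\<forall>\<phi> h. C1_test \<Omega> \<phi> h \<longrightarrow>
        (LINT x|lebesgue_on \<Omega>. g x \<bullet> h x) + \<kappa> * (LINT x|lebesgue_on \<Omega>. \<rho> x * u x * \<phi> x)
          = (LINT x|lebesgue_on \<Omega>. M x * \<phi> x))"

text \<open>All three test functions lie in the energy space, u by the definition of a weak
  solution.\<close>

lemma weak_solution_energy_balance:
  assumes \<Omega>: "open \<Omega>" "bounded \<Omega>" and int: "integrable (lebesgue_on \<Omega>) \<rho>" "integrable (lebesgue_on \<Omega>) M"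
    and u: "weak_solution \<Omega> \<kappa> M \<rho> u"
  shows "\<exists>g. energy_balance \<Omega> \<kappa> M \<rho> u g"
proof -
  obtain g where g: "energy_function \<Omega> M \<rho> u g"
    and eq: "\<And>\<phi> h. energy_function \<Omega> M \<rho> \<phi> h \<Longrightarrow>
      (LINT x|lebesgue_on \<Omega>. g x \<bullet> h x) + \<kappa> * (LINT x|lebesgue_on \<Omega>. \<rho> x * u x * \<phi> x)
         = (LINT x|lebesgue_on \<Omega>. M x * \<phi> x)"
    using u unfolding weak_solution_def by blast
  have "energy_balance \<Omega> \<kappa> M \<rho> u g"
    unfolding energy_balance_def
  proof (intro conjI allI impI)
    show "\<kappa> * (LINT x|lebesgue_on \<Omega>. \<rho> x * u x) = integral\<^sup>L (lebesgue_on \<Omega>) M"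
      using eq[OF energy_function_one[OF \<Omega> int]] by simp
    show "(LINT x|lebesgue_on \<Omega>. (norm (g x))\<^sup>2) + \<kappa> * (LINT x|lebesgue_on \<Omega>. \<rho> x * (u x)\<^sup>2)
       = (LINT x|lebesgue_on \<Omega>. M x * u x)"
      unfolding power2_norm_eq_inner using eq[OF g] by (simp add: power2_eq_square mult.assoc)
    show "(LINT x|lebesgue_on \<Omega>. g x \<bullet> h x) + \<kappa> * (LINT x|lebesgue_on \<Omega>. \<rho> x * u x * \<phi> x)
         = (LINT x|lebesgue_on \<Omega>. M x * \<phi> x)" if "C1_test \<Omega> \<phi> h" for \<phi> h
      by (rule eq[OF energy_function_C1_test[OF \<Omega> int that]])
  qed (use g in \<open>auto simp: energy_function_def H1_function_def\<close>)
  then show ?thesis by blast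
qed

text \<open>Green's identity for s times the gradient of u, a tangential field by the Neumann
  condition; s is then u, 1 or a compactly supported function.\<close>

lemma classical_solution_energy_balance:
  fixes \<Omega> :: "'a::euclidean_space set"
  assumes dom: "smooth_bounded_domain \<Omega>"
    and int: "integrable (lebesgue_on \<Omega>) \<rho>" "integrable (lebesgue_on \<Omega>) M"
    and u: "classical_solution \<Omega> \<kappa> M \<rho> u"
  shows "\<exists>g. energy_balance \<Omega> \<kappa> M \<rho> u g"
proof -
  let ?N = "lebesgue_on \<Omega>"
  have \<Omega>: "open \<Omega>" "bounded \<Omega>" using dom by (simp_all add: smooth_bounded_domain_def)
  have C2: "Ck_on 2 \<Omega> u" and ucont: "continuous_on (closure \<Omega>) u"
    and pde: "AE x in ?N. laplacian u x - \<kappa> * \<rho> x * u x = - M x"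
    using u by (auto simp: classical_solution_def)
  obtain G where G: "continuous_on (closure \<Omega>) G" "\<And>x. x \<in> \<Omega> \<Longrightarrow> G x = grad u x"
    "\<And>x n. x \<in> frontier \<Omega> \<Longrightarrow> outward_unit_normal \<Omega> x n \<Longrightarrow> G x \<bullet> n = 0"
    using u unfolding classical_solution_def by blast
  have pC1: "Ck_on 1 \<Omega> (partial b u)" if "b \<in> Basis" for b
    using C2 that by (simp add: numeral_2_eq_2)
  have pder: "(partial b u has_derivative (\<lambda>v. grad (partial b u) x \<bullet> v)) (at x)"
    if "b \<in> Basis" "x \<in> \<Omega>" for b x
    using pC1[OF that(1)] that(2) by (intro differentiable_has_derivative_grad) simp
  have uder: "(u has_derivative (\<lambda>v. G x \<bullet> v)) (at x)" if "x \<in> \<Omega>" for x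
    using C2 that by (simp add: G(2) numeral_2_eq_2 differentiable_has_derivative_grad)
  \<comment> \<open>The Hessian of u applied to v; its trace is the Laplacian.\<close>
  define F' where "F' = (\<lambda>x v. \<Sum>b\<in>Basis. (grad (partial b u) x \<bullet> v) *\<^sub>R b)"
  have Gder: "(G has_derivative F' x) (at x)" if "x \<in> \<Omega>" for x
  proof (rule has_derivative_transform_within_open[OF _ \<Omega>(1) that])
    show "(grad u has_derivative F' x) (at x)"
      unfolding grad_def F'_def using that
      by (intro has_derivative_sum has_derivative_scaleR_left pder[unfolded grad_def])
  qed (simp add: G(2))
  have F'cont: "continuous_on \<Omega> (\<lambda>x. F' x v)" for v
    unfolding F'_def by (intro continuous_intros Ck_on_1_continuous_grad pC1)
  have grad_Basis: "grad f x \<bullet> b = partial b f x" if "b \<in> Basis" for f :: "'a \<Rightarrow> real" and b x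
    using that by (simp add: grad_def inner_sum_left inner_Basis if_distrib[of "\<lambda>y. _ * y"] cong: if_cong)
  have div: "(\<Sum>i\<in>Basis. F' x i \<bullet> i) = laplacian u x" for x
  proof -
    have "F' x i \<bullet> i = partial i (partial i u) x" if "i \<in> Basis" for i
      using that unfolding F'_def
      by (simp add: inner_sum_left inner_Basis grad_Basis if_distrib[of "\<lambda>y. _ * y"] cong: if_cong)
    then show ?thesis by (simp add: laplacian_def)
  qed
  have lap_cont: "continuous_on \<Omega> (laplacian u)"
    unfolding div[symmetric] by (intro continuous_intros F'cont)
  have int_\<rho>u: "integrable ?N (\<lambda>x. u x * \<rho> x)"
    by (rule integrable_continuous_closure_mult[OF \<Omega> ucont int(1)])
  have pde': "AE x in ?N. laplacian u x = \<kappa> * (u x * \<rho> x) - M x"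
    using pde by eventually_elim (simp add: algebra_simps)
  have lap_meas: "laplacian u \<in> borel_measurable ?N"
    using \<Omega> by (intro continuous_imp_measurable_on_sets_lebesgue lap_cont) auto
  have int_rhs: "integrable ?N (\<lambda>x. \<kappa> * (u x * \<rho> x) - M x)"
    using int_\<rho>u int by simp
  \<comment> \<open>The second derivatives have no bound near the boundary, but the equation
    expresses the Laplacian through integrable functions.\<close>
  have "integrable ?N (laplacian u)"
    using integrable_cong_AE[OF lap_meas borel_measurable_integrable[OF int_rhs] pde'] int_rhs by blast
  then have tf: "tangential_field \<Omega> G F'"
    unfolding tangential_field_def div using G Gder F'cont by auto
  have key: "(LINT x|?N. G x \<bullet> h x) + \<kappa> * (LINT x|?N. \<rho> x * u x * s x) = (LINT x|?N. M x * s x)"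
    if s: "continuous_on (closure \<Omega>) s" "\<And>x. x \<in> \<Omega> \<Longrightarrow> (s has_derivative (\<lambda>v. h x \<bullet> v)) (at x)"
      "continuous_on (closure \<Omega>) h" for s h
  proof -
    have i1: "integrable ?N (\<lambda>x. G x \<bullet> h x)"
      by (intro integrable_continuous_closure[OF \<Omega>] continuous_intros G s)
    have i2: "integrable ?N (\<lambda>x. \<rho> x * u x * s x)"
      using integrable_continuous_closure_mult[OF \<Omega> s(1) int_\<rho>u] by (simp add: ac_simps)
    have i3: "integrable ?N (\<lambda>x. M x * s x)"
      using integrable_continuous_closure_mult[OF \<Omega> s(1) int(2)] by (simp add: ac_simps)
    have "0 = (LINT x|?N. (\<Sum>b\<in>Basis. (s x *\<^sub>R F' x b + (h x \<bullet> b) *\<^sub>R G x) \<bullet> b))"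
      by (rule divergence_theorem_tangential[OF dom tangential_field_scaleR[OF \<Omega> tf s], symmetric])
    also have "\<dots> = (LINT x|?N. s x * laplacian u x + h x \<bullet> G x)"
      by (simp add: trace_scaleR_add div)
    also have "\<dots> = (LINT x|?N. G x \<bullet> h x + \<kappa> * (\<rho> x * u x * s x) - M x * s x)"
    proof (rule integral_cong_AE)
      have "s \<in> borel_measurable ?N" "h \<in> borel_measurable ?N" "G \<in> borel_measurable ?N"
        using \<Omega> s G(1) closure_subset
        by (auto intro!: continuous_imp_measurable_on_sets_lebesgue intro: continuous_on_subset)
      then show "(\<lambda>x. s x * laplacian u x + h x \<bullet> G x) \<in> borel_measurable ?N"
        using lap_meas by measurable
      show "(\<lambda>x. G x \<bullet> h x + \<kappa> * (\<rho> x * u x * s x) - M x * s x) \<in> borel_measurable ?N"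
        using i1 i2 i3 by (intro borel_measurable_integrable) auto
      show "AE x in ?N. s x * laplacian u x + h x \<bullet> G x = G x \<bullet> h x + \<kappa> * (\<rho> x * u x * s x) - M x * s x"
        using pde'
      proof eventually_elim
        case (elim x)
        show ?case unfolding elim by (simp add: algebra_simps inner_commute)
      qed
    qed
    also have "\<dots> = (LINT x|?N. G x \<bullet> h x) + \<kappa> * (LINT x|?N. \<rho> x * u x * s x) - (LINT x|?N. M x * s x)"
      using i1 i2 i3 by simp
    finally show ?thesis by simp
  qed
  have "energy_balance \<Omega> \<kappa> M \<rho> u G"
    unfolding energy_balance_def
  proof (intro conjI allI impI)
    show "u \<in> borel_measurable ?N"
      using \<Omega> ucont closure_subset
      by (intro continuous_imp_measurable_on_sets_lebesgue) (auto intro: continuous_on_subset)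
    show "integrable ?N (\<lambda>x. (norm (G x))\<^sup>2)"
      by (intro integrable_continuous_closure[OF \<Omega>] continuous_intros G)
    show "integrable ?N (\<lambda>x. \<rho> x * (u x)\<^sup>2)" 
      using integrable_continuous_closure_mult[OF \<Omega> _ int(1), of "\<lambda>x. (u x)\<^sup>2"] ucont
      by (simp add: mult.commute continuous_intros)
    show "integrable ?N (\<lambda>x. M x * u x)"
      using integrable_continuous_closure_mult[OF \<Omega> ucont int(2)] by (simp add: mult.commute)
    show "(LINT x|?N. (norm (G x))\<^sup>2) + \<kappa> * (LINT x|?N. \<rho> x * (u x)\<^sup>2) = (LINT x|?N. M x * u x)"
      unfolding power2_norm_eq_inner
      using key[OF ucont uder G(1)] by (simp add: power2_eq_square mult.assoc)
    show "\<kappa> * (LINT x|?N. \<rho> x * u x) = integral\<^sup>L ?N M"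
      using key[of "\<lambda>x. 1" "\<lambda>x. 0"] by simp
    show "(LINT x|?N. G x \<bullet> h x) + \<kappa> * (LINT x|?N. \<rho> x * u x * \<phi> x) = (LINT x|?N. M x * \<phi> x)"
      if "C1_test \<Omega> \<phi> h" for \<phi> h
      using C1_test_continuous[OF that] that
      by (intro key) (auto simp: C1_test_def intro: continuous_on_subset)
  qed
  then show ?thesis by blast
qed

lemma mfpt_solution_energy_balance:
  assumes "smooth_bounded_domain \<Omega>" "integrable (lebesgue_on \<Omega>) \<rho>" "integrable (lebesgue_on \<Omega>) M"
    "mfpt_solution \<Omega> \<kappa> M \<rho> u"
  shows "\<exists>g. energy_balance \<Omega> \<kappa> M \<rho> u g"
  using assms classical_solution_energy_balance weak_solution_energy_balance
  unfolding mfpt_solution_def smooth_bounded_domain_def by metis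

section \<open>The excess over the lower bound and the case of equality\<close>

text \<open>With \<open>c = |M| / \<kappa>\<close> this is \<open>\<integral> M u = \<integral> |g|\<^sup>2 + \<kappa> \<integral> \<rho> (u - c)\<^sup>2 + \<kappa> c\<^sup>2\<close>.\<close>

lemma energy_balance_excess:
  fixes \<kappa> :: real
  assumes \<rho>: "trap_density \<Omega> \<rho>" and eb: "energy_balance \<Omega> \<kappa> M \<rho> u g" and \<kappa>: "0 < \<kappa>"
  defines "c \<equiv> integral\<^sup>L (lebesgue_on \<Omega>) M / \<kappa>"
  shows "integrable (lebesgue_on \<Omega>) (\<lambda>x. \<rho> x * (u x - c)\<^sup>2)"
    "(LINT x|lebesgue_on \<Omega>. M x * u x) = (LINT x|lebesgue_on \<Omega>. (norm (g x))\<^sup>2)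
       + \<kappa> * (LINT x|lebesgue_on \<Omega>. \<rho> x * (u x - c)\<^sup>2) + \<kappa> * c\<^sup>2"
proof -
  let ?N = "lebesgue_on \<Omega>"
  have \<rho>int: "integrable ?N \<rho>" "integral\<^sup>L ?N \<rho> = 1" using \<rho> by (simp_all add: trap_density_def)
  have [measurable]: "u \<in> borel_measurable ?N" and \<rho>u2: "integrable ?N (\<lambda>x. \<rho> x * (u x)\<^sup>2)"
    and e1: "(LINT x|?N. (norm (g x))\<^sup>2) + \<kappa> * (LINT x|?N. \<rho> x * (u x)\<^sup>2) = (LINT x|?N. M x * u x)"
    and e2: "\<kappa> * (LINT x|?N. \<rho> x * u x) = integral\<^sup>L ?N M"
    using eb by (simp_all add: energy_balance_def)
  \<comment> \<open>Since |u| \<le> 1 + u^2, the product \<rho> u is dominated by \<rho> and \<rho>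
    u^2.\<close>
  have \<rho>u: "integrable ?N (\<lambda>x. \<rho> x * u x)"
  proof (rule Bochner_Integration.integrable_bound[of _ "\<lambda>x. \<bar>\<rho> x\<bar> + \<bar>\<rho> x * (u x)\<^sup>2\<bar>"])
    have "\<bar>\<rho> x * u x\<bar> \<le> \<bar>\<rho> x\<bar> + \<bar>\<rho> x * (u x)\<^sup>2\<bar>" for x
    proof -
      have "\<bar>u x\<bar> \<le> 1 + (u x)\<^sup>2"
        using sum_power2_ge_zero[of "\<bar>u x\<bar> - 1" 0] by (simp add: power2_eq_square algebra_simps) 
      then have "\<bar>\<rho> x\<bar> * \<bar>u x\<bar> \<le> \<bar>\<rho> x\<bar> * (1 + (u x)\<^sup>2)" by (intro mult_left_mono) auto
      then show ?thesis by (simp add: abs_mult algebra_simps)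
    qed
    then show "AE x in ?N. norm (\<rho> x * u x) \<le> norm (\<bar>\<rho> x\<bar> + \<bar>\<rho> x * (u x)\<^sup>2\<bar>)"
      by (auto intro!: AE_I2 order_trans[OF _ abs_ge_self])
  qed (use \<rho>int \<rho>u2 in auto)
  have expand: "\<rho> x * (u x - c)\<^sup>2 = \<rho> x * (u x)\<^sup>2 - 2 * c * (\<rho> x * u x) + c\<^sup>2 * \<rho> x" for x
    by (simp add: power2_eq_square algebra_simps)
  show "integrable ?N (\<lambda>x. \<rho> x * (u x - c)\<^sup>2)"
    unfolding expand using \<rho>int \<rho>u \<rho>u2 by simp
  \<comment> \<open>c is the mean of u under the probability density \<rho>, so the next integral is
    a variance; its nonnegativity is the Jensen step.\<close>
  have "(LINT x|?N. \<rho> x * u x) = c" using e2 \<kappa> by (simp add: c_def field_simps)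
  then have "(LINT x|?N. \<rho> x * (u x - c)\<^sup>2) = (LINT x|?N. \<rho> x * (u x)\<^sup>2) - c\<^sup>2"
    unfolding expand using \<rho>int \<rho>u \<rho>u2 by (simp add: power2_eq_square)
  then show "(LINT x|?N. M x * u x) = (LINT x|?N. (norm (g x))\<^sup>2)
       + \<kappa> * (LINT x|?N. \<rho> x * (u x - c)\<^sup>2) + \<kappa> * c\<^sup>2"
    using e1 by (simp add: right_diff_distrib)
qed

text \<open>Equality makes both nonnegative excess terms vanish. Conversely, if \<rho> = M / m, then
  \<integral> M u is m times \<integral> \<rho> u, which testing with 1 fixes at m / \<kappa>. So
  every solution for this \<rho> attains the bound, and the third claim follows.\<close>

lemma energy_balance_optimality:
  fixes \<kappa> :: real
  assumes \<Omega>: "open \<Omega>" "bounded \<Omega>" and \<rho>: "trap_density \<Omega> \<rho>" and eb: "energy_balance \<Omega> \<kappa> M \<rho> u g"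
    and \<kappa>: "0 < \<kappa>" and M: "integrable (lebesgue_on \<Omega>) M"
    and mass: "m = integral\<^sup>L (lebesgue_on \<Omega>) M" "0 < m"
  shows "m\<^sup>2 / \<kappa> \<le> (LINT x|lebesgue_on \<Omega>. M x * u x)"
    "(LINT x|lebesgue_on \<Omega>. M x * u x) = m\<^sup>2 / \<kappa> \<longleftrightarrow> (AE x in lebesgue_on \<Omega>. \<rho> x = M x / m)"
    "AE x in lebesgue_on \<Omega>. \<rho> x = M x / m \<Longrightarrow> AE x in lebesgue_on \<Omega>. \<rho> x * (u x - m / \<kappa>)\<^sup>2 = 0"
proof -
  let ?N = "lebesgue_on \<Omega>"
  define c where "c = m / \<kappa>"
  have \<rho>int: "integrable ?N \<rho>" "integral\<^sup>L ?N \<rho> = 1" and \<rho>pos: "AE x in ?N. 0 \<le> \<rho> x"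
    using \<rho> by (simp_all add: trap_density_def)
  have gint: "integrable ?N (\<lambda>x. (norm (g x))\<^sup>2)" and umeas[measurable]: "u \<in> borel_measurable ?N"
    and e2: "\<kappa> * (LINT x|?N. \<rho> x * u x) = m"
    and e3: "\<And>\<phi> h. C1_test \<Omega> \<phi> h \<Longrightarrow> (LINT x|?N. g x \<bullet> h x) + \<kappa> * (LINT x|?N. \<rho> x * u x * \<phi> x)
          = (LINT x|?N. M x * \<phi> x)"
    using eb mass by (simp_all add: energy_balance_def)
  have [measurable]: "\<rho> \<in> borel_measurable ?N" "M \<in> borel_measurable ?N" using \<rho>int M by auto
  note ex = energy_balance_excess[OF \<rho> eb \<kappa>, folded mass(1), folded c_def]
  have sq: "AE x in ?N. 0 \<le> \<rho> x * (u x - c)\<^sup>2"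
    using \<rho>pos by eventually_elim simp
  have ge: "0 \<le> (LINT x|?N. \<rho> x * (u x - c)\<^sup>2)" "0 \<le> (LINT x|?N. (norm (g x))\<^sup>2)"
    using sq by (auto intro: integral_nonneg_AE)
  have c2: "\<kappa> * c\<^sup>2 = m\<^sup>2 / \<kappa>" using \<kappa> by (simp add: c_def power2_eq_square)
  show "m\<^sup>2 / \<kappa> \<le> (LINT x|?N. M x * u x)"
    unfolding ex(2) using ge \<kappa> c2 by simp
  have zero: "AE x in ?N. g x = 0" "AE x in ?N. \<rho> x * (u x - c)\<^sup>2 = 0"
    if "(LINT x|?N. M x * u x) = m\<^sup>2 / \<kappa>"
  proof -
    have "(LINT x|?N. (norm (g x))\<^sup>2) + \<kappa> * (LINT x|?N. \<rho> x * (u x - c)\<^sup>2) = 0"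
      using that ex(2) c2 by simp
    moreover have "0 \<le> \<kappa> * (LINT x|?N. \<rho> x * (u x - c)\<^sup>2)" using ge \<kappa> by simp
    ultimately have "(LINT x|?N. (norm (g x))\<^sup>2) = 0" "\<kappa> * (LINT x|?N. \<rho> x * (u x - c)\<^sup>2) = 0"
      using ge(2) by linarith+
    then show "AE x in ?N. g x = 0" "AE x in ?N. \<rho> x * (u x - c)\<^sup>2 = 0"
      using integral_nonneg_eq_0_iff_AE[OF gint] integral_nonneg_eq_0_iff_AE[OF ex(1) sq] \<kappa> by auto
  qed
  have conv: "(LINT x|?N. M x * u x) = m\<^sup>2 / \<kappa>" if "AE x in ?N. \<rho> x = M x / m"
  proof -
    have "(LINT x|?N. M x * u x) = (LINT x|?N. m * (\<rho> x * u x))"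
      by (rule integral_cong_AE) (use that mass(2) in auto)
    also have "\<dots> = m * (m / \<kappa>)" using e2 \<kappa> by (simp add: field_simps)
    finally show ?thesis by (simp add: power2_eq_square)
  qed
  have "AE x in ?N. \<rho> x = M x / m" if eq: "(LINT x|?N. M x * u x) = m\<^sup>2 / \<kappa>"
  proof -
    have "AE x in ?N. m * \<rho> x - M x = 0"
    proof (rule AE_zero_if_C1_test_integrals_zero[OF \<Omega>(1)])
      show "integrable ?N (\<lambda>x. m * \<rho> x - M x)" using \<rho>int M by simp
      show "(LINT x|?N. m * \<rho> x - M x) = 0" using \<rho>int M mass by simp
      fix \<phi> h assume \<phi>: "C1_test \<Omega> \<phi> h"
      have cont: "continuous_on A \<phi>" for A
        using C1_test_continuous[OF \<phi>] by (rule continuous_on_subset) simp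
      have [measurable]: "\<phi> \<in> borel_measurable ?N"
        using \<Omega>(1) by (intro continuous_imp_measurable_on_sets_lebesgue cont) auto
      have int: "integrable ?N (\<lambda>x. f x * \<phi> x)" if "integrable ?N f" for f
        using integrable_continuous_closure_mult[OF \<Omega> cont that] by (simp add: mult.commute)
      have "(LINT x|?N. g x \<bullet> h x) = 0"
        by (rule integral_eq_zero_AE) (use zero(1)[OF eq] in auto)
      \<comment> \<open>At almost every point \<rho> = 0 or u = c, and either way \<rho> u = c
        \<rho>, whatever u is where \<rho> vanishes.\<close>
      moreover have "(LINT x|?N. \<rho> x * u x * \<phi> x) = (LINT x|?N. c * (\<rho> x * \<phi> x))"
      proof (rule integral_cong_AE)
        show "AE x in ?N. \<rho> x * u x * \<phi> x = c * (\<rho> x * \<phi> x)"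
          using zero(2)[OF eq] by eventually_elim auto
      qed measurable
      ultimately have "\<kappa> * (c * (LINT x|?N. \<rho> x * \<phi> x)) = (LINT x|?N. M x * \<phi> x)"
        using e3[OF \<phi>] by simp
      \<comment> \<open>As \<kappa> c = m and the gradient term is gone, the equation has become m
        \<rho> = M in weak form.\<close>
      then have "m * (LINT x|?N. \<rho> x * \<phi> x) = (LINT x|?N. M x * \<phi> x)"
        using \<kappa> by (simp add: c_def)
      moreover have "(LINT x|?N. (m * \<rho> x - M x) * \<phi> x) = m * (LINT x|?N. \<rho> x * \<phi> x) - (LINT x|?N. M x * \<phi> x)"
        using int[OF \<rho>int(1)] int[OF M] by (simp add: left_diff_distrib mult.assoc)
      ultimately show "(LINT x|?N. (m * \<rho> x - M x) * \<phi> x) = 0" by simp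
    qed
    then show ?thesis
      by eventually_elim (use mass(2) in \<open>simp add: field_simps\<close>)
  qed
  then show "(LINT x|?N. M x * u x) = m\<^sup>2 / \<kappa> \<longleftrightarrow> (AE x in ?N. \<rho> x = M x / m)"
    using conv by blast
  show "AE x in ?N. \<rho> x * (u x - m / \<kappa>)\<^sup>2 = 0" if "AE x in ?N. \<rho> x = M x / m"
    using zero(2)[OF conv[OF that]] by (simp add: c_def)
qed

section \<open>From almost everywhere to everywhere, and the conclusion\<close>

lemma empty_if_AE_lebesgue_on_False:
  assumes "open S" "AE x in lebesgue_on \<Omega>. x \<notin> S" "S \<subseteq> \<Omega>" "open \<Omega>"
  shows "S = {}"
proof -
  have "AE x \<in> \<Omega> in lebesgue. x \<notin> S"
    using assms by (subst AE_restrict_space_iff[symmetric]) auto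
  \<comment> \<open>An open set almost all of whose points lie in a closed set is contained in it;
    the closed set is taken empty.\<close>
  then have "AE x \<in> S in lebesgue. x \<in> {}"
    by eventually_elim (use assms(3) in auto)
  then show ?thesis
    using mem_closed_if_AE_lebesgue_open[OF assms(1) closed_empty] by auto
qed

text \<open>For constant u the equation is algebraic, and G = 0 meets the boundary
  condition.\<close>

lemma classical_solution_const:
  assumes "\<And>x. \<kappa> * \<rho> x * c = M x"
  shows "classical_solution \<Omega> \<kappa> M \<rho> (\<lambda>x. c)"
proof -
  have p: "partial b (\<lambda>x. a) = (\<lambda>x. 0)" for b :: 'a and a :: real
    by (simp add: partial_def fun_eq_iff)
  show ?thesis
    unfolding classical_solution_def
    by (auto simp: numeral_2_eq_2 p laplacian_def grad_def assms intro!: exI[of _ "\<lambda>x. 0"])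
qed

text \<open>Integrability of M is assumed because D is smooth only on the open set and may tend to 0
  at the boundary. The minimality clause compares all solutions for \<rho> with all solutions for
  \<mu>; the constant shows that the latter exist. Variational solutions are determined only up to
  null sets, hence the separate pointwise claim for classical ones.\<close>

theorem theorem1p1:
  fixes \<Omega> :: "(real ^ 'd) set" and D :: "real ^ 'd \<Rightarrow> real" and \<kappa> :: real
    and M \<mu> :: "real ^ 'd \<Rightarrow> real" and mass :: real
  assumes dim: "CARD('d) = 2 \<or> CARD('d) = 3"
    and domain: "smooth_bounded_domain \<Omega>"
    and D_smooth: "smooth_on \<Omega> D"
    and D_pos: "\<forall>x\<in>\<Omega>. 0 < D x"
    and M_def: "M = (\<lambda>x. 1 / D x)"
    and M_integrable: "integrable (lebesgue_on \<Omega>) M"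
    and mass_def: "mass = (LINT x|lebesgue_on \<Omega>. M x)"
    and mu_def: "\<mu> = (\<lambda>x. M x / mass)"
    and kappa_pos: "0 < \<kappa>"
  shows
    "(\<forall>\<rho> u. trap_density \<Omega> \<rho> \<and> mfpt_solution \<Omega> \<kappa> M \<rho> u \<longrightarrow>
        integrable (lebesgue_on \<Omega>) (\<lambda>x. \<mu> x * u x) \<and>
        mean_capture_time \<Omega> \<mu> u \<ge> mass / \<kappa> \<and>
        (mean_capture_time \<Omega> \<mu> u = mass / \<kappa> \<longleftrightarrow> (AE x in lebesgue_on \<Omega>. \<rho> x = \<mu> x))) \<and>
     trap_density \<Omega> \<mu> \<and>
     (\<forall>\<rho> u v. trap_density \<Omega> \<rho> \<and> mfpt_solution \<Omega> \<kappa> M \<rho> u \<and> mfpt_solution \<Omega> \<kappa> M \<mu> v \<longrightarrow>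
        mean_capture_time \<Omega> \<mu> v \<le> mean_capture_time \<Omega> \<mu> u \<and>
        (mean_capture_time \<Omega> \<mu> u = mean_capture_time \<Omega> \<mu> v \<longrightarrow>
           (AE x in lebesgue_on \<Omega>. \<rho> x = \<mu> x))) \<and>
     mfpt_solution \<Omega> \<kappa> M \<mu> (\<lambda>x. mass / \<kappa>) \<and>
     (\<forall>u. mfpt_solution \<Omega> \<kappa> M \<mu> u \<longrightarrow> (AE x in lebesgue_on \<Omega>. u x = mass / \<kappa>)) \<and>
     (\<forall>u. classical_solution \<Omega> \<kappa> M \<mu> u \<longrightarrow> (\<forall>x\<in>closure \<Omega>. u x = mass / \<kappa>))"
proof -
  let ?N = "lebesgue_on \<Omega>"
  have \<Omega>: "open \<Omega>" "bounded \<Omega>" "\<Omega> \<noteq> {}" using domain by (simp_all add: smooth_bounded_domain_def)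
  have M_pos: "0 < M x" if "x \<in> \<Omega>" for x using D_pos that by (simp add: M_def)
  have M_nonneg: "AE x in ?N. 0 \<le> M x"
    by (intro AE_I2) (use M_pos in \<open>auto simp: less_imp_le\<close>)
  \<comment> \<open>M is positive on \<Omega>, so zero mass would make the nonempty open set
    \<Omega> null.\<close>
  have "mass \<noteq> 0"
  proof
    assume "mass = 0"
    then have "AE x in ?N. M x = 0"
      using integral_nonneg_eq_0_iff_AE[OF M_integrable M_nonneg] by (simp add: mass_def)
    with AE_space have "AE x in ?N. x \<notin> \<Omega>"
      by eventually_elim (use M_pos in fastforce)
    then show False using empty_if_AE_lebesgue_on_False[of \<Omega> \<Omega>] \<Omega> by simp
  qed
  moreover have "0 \<le> mass" unfolding mass_def using M_nonneg by (rule integral_nonneg_AE)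
  ultimately have mass_pos: "0 < mass" by simp
  have td: "trap_density \<Omega> \<mu>"
    unfolding trap_density_def mu_def using M_integrable M_nonneg mass_pos mass_def by auto
  have main: "integrable ?N (\<lambda>x. \<mu> x * u x) \<and> mean_capture_time \<Omega> \<mu> u \<ge> mass / \<kappa> \<and>
      (mean_capture_time \<Omega> \<mu> u = mass / \<kappa> \<longleftrightarrow> (AE x in ?N. \<rho> x = \<mu> x))"
    if \<rho>: "trap_density \<Omega> \<rho>" and u: "mfpt_solution \<Omega> \<kappa> M \<rho> u" for \<rho> u
  proof -
    obtain g where eb: "energy_balance \<Omega> \<kappa> M \<rho> u g"
      using mfpt_solution_energy_balance[OF domain _ M_integrable u] \<rho> by (auto simp: trap_density_def)
    note opt = energy_balance_optimality[OF \<Omega>(1,2) \<rho> eb kappa_pos M_integrable mass_def mass_pos]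
    have mct: "mean_capture_time \<Omega> \<mu> u = (LINT x|?N. M x * u x) / mass"
      by (simp add: mean_capture_time_def mu_def)
    have "integrable ?N (\<lambda>x. \<mu> x * u x)"
      using eb by (simp add: energy_balance_def mu_def)
    moreover have "mass / \<kappa> \<le> mean_capture_time \<Omega> \<mu> u"
      using opt(1) mass_pos kappa_pos by (simp add: mct field_simps power2_eq_square)
    moreover have "mean_capture_time \<Omega> \<mu> u = mass / \<kappa> \<longleftrightarrow> (LINT x|?N. M x * u x) = mass\<^sup>2 / \<kappa>"
      using mass_pos kappa_pos by (simp add: mct field_simps power2_eq_square)
    ultimately show ?thesis using opt(2) by (simp add: mu_def)
  qed
  have const: "AE x in ?N. u x = mass / \<kappa>" if u: "mfpt_solution \<Omega> \<kappa> M \<mu> u" for u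
  proof -
    obtain g where eb: "energy_balance \<Omega> \<kappa> M \<mu> u g"
      using mfpt_solution_energy_balance[OF domain _ M_integrable u] td by (auto simp: trap_density_def)
    have "AE x in ?N. \<mu> x * (u x - mass / \<kappa>)\<^sup>2 = 0"
      by (rule energy_balance_optimality(3)[OF \<Omega>(1,2) td eb kappa_pos M_integrable mass_def mass_pos])
        (simp add: mu_def)
    with AE_space show ?thesis
    proof eventually_elim
      case (elim x)
      then have "\<mu> x \<noteq> 0" using M_pos[of x] mass_pos by (simp add: mu_def)
      with elim show ?case by simp
    qed
  qed
  have classical: "u x = mass / \<kappa>" if u: "classical_solution \<Omega> \<kappa> M \<mu> u" and x: "x \<in> closure \<Omega>" for u x
  proof (rule continuous_constant_on_closure[OF _ _ x])
    show cont: "continuous_on (closure \<Omega>) u" using u by (simp add: classical_solution_def)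
    \<comment> \<open>The points of \<Omega> where u differs from the constant form an open null
      set, hence none; continuity extends the value to the closure.\<close>
    have "open (\<Omega> \<inter> u -` (- {mass / \<kappa>}))"
      using \<Omega> by (intro continuous_open_preimage continuous_on_subset[OF cont closure_subset]) auto
    moreover have "AE x in ?N. x \<notin> \<Omega> \<inter> u -` (- {mass / \<kappa>})"
      using const[of u] u by (auto simp: mfpt_solution_def)
    ultimately have "\<Omega> \<inter> u -` (- {mass / \<kappa>}) = {}"
      using \<Omega>(1) by (rule empty_if_AE_lebesgue_on_False[OF _ _ Int_lower1])
    then show "u y = mass / \<kappa>" if "y \<in> \<Omega>" for y using that by auto
  qed
  have "mfpt_solution \<Omega> \<kappa> M \<mu> (\<lambda>x. mass / \<kappa>)"
    unfolding mfpt_solution_def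
    using kappa_pos mass_pos by (intro disjI1 classical_solution_const) (simp add: mu_def)
  moreover have "mean_capture_time \<Omega> \<mu> v \<le> mean_capture_time \<Omega> \<mu> u \<and>
      (mean_capture_time \<Omega> \<mu> u = mean_capture_time \<Omega> \<mu> v \<longrightarrow> (AE x in ?N. \<rho> x = \<mu> x))"
    if "trap_density \<Omega> \<rho>" "mfpt_solution \<Omega> \<kappa> M \<rho> u" "mfpt_solution \<Omega> \<kappa> M \<mu> v" for \<rho> u v
    using main[OF that(1,2)] main[OF td that(3)] by simp
  ultimately show ?thesis
    using main td const classical by blast
qed

end
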